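(* Let $\lambda\in P$ and $w\in W$. Let $\Gamma,\Xi$ be alcove paths from $A_\circ$ to $A_\lambda=A_\circ+\lambda$, and assume that $\Xi$ is obtained from $\Gamma$ by a deletion procedure (D). Then there exists a subset $\widetilde{\mathbf{QW}}^{(1)}_{\lambda,w}(\Gamma)\subset\widetilde{\mathbf{QW}}_{\lambda,w}(\Gamma)$ such that the following hold. (1) There exists a bijection $\mathsf{D}:\widetilde{\mathbf{QW}}^{(1)}_{\lambda,w}(\Gamma)\to\widetilde{\mathbf{QW}}_{\lambda,w}(\Xi)$ such that for all $(\mathbf{w},\mathbf{b})\in\widetilde{\mathbf{QW}}^{(1)}_{\lambda,w}(\Gamma)$: $(-1)^{\mathsf{D}(\mathbf{w},\mathbf{b})}=(-1)^{(\mathbf{w},\mathbf{b})}$, $\mathrm{end}(\mathsf{D}(\mathbf{w},\mathbf{b}))=\mathrm{end}(\mathbf{w},\mathbf{b})$, $\mathrm{qwt}(\mathsf{D}(\mathbf{w},\mathbf{b}))=\mathrm{qwt}(\mathbf{w},\mathbf{b})$, $\mathrm{qwt}^\vee(\mathsf{D}(\mathbf{w},\mathbf{b}))=\mathrm{qwt}^\vee(\mathbf{w},\mathbf{b})$, $\mathrm{wt}(\mathsf{D}(\mathbf{w},\mathbf{b}))=\mathrm{wt}(\mathbf{w},\mathbf{b})$, $\deg(\mathsf{D}(\mathbf{w},\mathbf{b}))=\deg(\mathbf{w},\mathbf{b})$. (2) There exists an involution $\mathsf{D}$ on $\widetilde{\mathbf{QW}}_{\lambda,w}(\Gamma)\setminus\widetilde{\mathbf{QW}}^{(1)}_{\lambda,w}(\Gamma)$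 such that for all $(\mathbf{w},\mathbf{b})$ in this set: $(-1)^{\mathsf{D}(\mathbf{w},\mathbf{b})}=-(-1)^{(\mathbf{w},\mathbf{b})}$, $\mathrm{end}(\mathsf{D}(\mathbf{w},\mathbf{b}))=\mathrm{end}(\mathbf{w},\mathbf{b})$, $\mathrm{qwt}(\mathsf{D}(\mathbf{w},\mathbf{b}))=\mathrm{qwt}(\mathbf{w},\mathbf{b})$, $\mathrm{qwt}^\vee(\mathsf{D}(\mathbf{w},\mathbf{b}))=\mathrm{qwt}^\vee(\mathbf{w},\mathbf{b})$, $\mathrm{wt}(\mathsf{D}(\mathbf{w},\mathbf{b}))=\mathrm{wt}(\mathbf{w},\mathbf{b})$, $\deg(\mathsf{D}(\mathbf{w},\mathbf{b}))=\deg(\mathbf{w},\mathbf{b})$.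
   Context: **Root data.** $G$ is a simply-connected simple algebraic group over $\mathbb{C}$ of simply-laced type, not of type $E_8$, with maximal torus $H$, $\mathfrak{h}=\mathrm{Lie}(H)$, $\langle\cdot,\cdot\rangle:\mathfrak{h}^*\times\mathfrak{h}\to\mathbb{C}$ the pairing. $\Delta$ is the root system, $\Delta^+$ the positive roots, $\Delta^-=-\Delta^+$, $\alpha^\vee$ the coroot of $\alpha$, $\rho=\frac12\sum_{\alpha\in\Delta^+}\alpha$, $Q$ and $Q^\vee$ the root and coroot lattices, $P$ the weight lattice, $\mathfrak{h}^*_{\mathbb{R}}=\mathbb{R}\otimes P$. For $\alpha\in\Delta$: $\mathrm{sgn}(\alpha)=\pm1$ if $\alpha\in\Delta^{\pm}$, $|\alpha|=\mathrm{sgn}(\alpha)\alpha$, $s_\alpha\nu=\nu-\langle\nu,\alpha^\vee\rangle\alpha$. $W$ is the Weyl group, $\ell$ its length function, $<$ its Bruhat order. **Quantum Bruhat graph.** $\mathrm{QBG}(W)$ is the directed graph with vertex set $W$ and edges $x\xrightarrow{\alpha}y$, labeled by $\alpha\in\Delta^+$, whenever $y=xs_\alpha$ and either $\ell(y)=\ell(x)+1$ (Bruhat edge) or $\ell(y)=\ell(x)-2\langle\rho,\alpha^\vee\rangle+1$ (quantum edge). **Alcove paths.** For $\alpha\in\Delta$, $k\in\mathbb{Z}$: $H_{\alpha,k}=\{\nu\in\mathfrak{h}^*_{\mathbb{R}}\mid\langle\nu,\alpha^\vee\rangle=k\}$, and $\hat r_{\alpha,k}(\nu)=s_\alpha\nu+k\alpha$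 is the affine reflection in it. Alcoves are the open regions cut out by all the $H_{\alpha,k}$; $A_\circ=\{\nu\mid 0<\langle\nu,\alpha^\vee\rangle<1\ \forall\alpha\in\Delta^+\}$. For adjacent (distinct, sharing a wall) alcoves, $A\xrightarrow{\alpha}B$ means the common wall is orthogonal to $\alpha\in\Delta$ and $\alpha$ points in the direction from $A$ to $B$. An alcove path from $A_\circ$ to $A_\lambda:=A_\circ+\lambda$ is a sequence of successively adjacent alcoves $A_\circ=A_0\xrightarrow{\gamma_1}A_1\xrightarrow{\gamma_2}\cdots\xrightarrow{\gamma_m}A_m=A_\lambda$, written $\Gamma=(\gamma_1,\dots,\gamma_m)$. $H_{\gamma_t,l_t}$ denotes the hyperplane between $A_{t-1}$ and $A_t$, and $l_t'=\langle\lambda,\gamma_t^\vee\rangle-l_t$. **Deletion procedure (D).** Delete from the sequence of roots of the path a segment of two consecutive roots of the form $\alpha,-\alpha$ with $\alpha\in\Delta$. **Decorated quantum walks.** For $w\in W$ and $\Gamma=(\gamma_1,\dots,\gamma_m)$ an alcove path from $A_\circ$ to $A_\lambda$, $\mathbf{QW}_{\lambda,w}(\Gamma)$ is the set of sequences $\mathbf{w}=(w_0,\dots,w_m)$ in $W$ with $w_0=w$, $w_t\in\{w_{t-1},s_{\gamma_t}w_{t-1}\}$ for $1\le t\le m$, and such that whenever $w_t=s_{\gamma_t}w_{t-1}$, $w_{t-1}\to w_t$ is an edge of $\mathrm{QBG}(W)$. Set $T(\mathbf{w})=\{t\mid w_t=s_{\gamma_t}w_{t-1}\}$, $T^-(\mathbf{w})=\{t\mid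 w_{t-1}>w_t\}$, $S(\mathbf{w})=\{t\mid w_t=w_{t-1}\text{ and }-w_t^{-1}\gamma_t\text{ is a simple root}\}$. $\widetilde{\mathbf{QW}}_{\lambda,w}(\Gamma)$ is the set of pairs $(\mathbf{w},\mathbf{b})$ with $\mathbf{w}\in\mathbf{QW}_{\lambda,w}(\Gamma)$ and $\mathbf{b}:S(\mathbf{w})\to\{0,1\}$. For such a pair: - $\mathrm{end}(\mathbf{w},\mathbf{b})=\mathrm{end}(\mathbf{w})=w_m$; - $(-1)^{(\mathbf{w},\mathbf{b})}=\prod_{t\in T(\mathbf{w}),\,w_{t-1}^{-1}\gamma_t\in\Delta^+}(-1)\cdot\prod_{t\in S(\mathbf{w})}(-1)^{\mathbf{b}(t)}$; - $\mathrm{qwt}_t(\mathbf{w},\mathbf{b})=\sum_{u\le t,\,u\in T^-(\mathbf{w})}|w_u^{-1}\gamma_u|-\sum_{u\le t,\,u\in S(\mathbf{w})}\mathbf{b}(u)w_u^{-1}\gamma_u\in Q$, $\mathrm{qwt}=\mathrm{qwt}_m$; $\mathrm{qwt}^\vee_t(\mathbf{w},\mathbf{b})=\sum_{u\le t,\,u\in T^-(\mathbf{w})}|w_u^{-1}\gamma_u|^\vee-\sum_{u\le t,\,u\in S(\mathbf{w})}\mathbf{b}(u)w_u^{-1}\gamma_u^\vee\in Q^\vee$, $\mathrm{qwt}^\vee=\mathrm{qwt}^\vee_m$; - $\hat r_0(\mathbf{w})=w^{-1}$, $\hat r_t(\mathbf{w})=\hat r_{t-1}(\mathbf{w})\hat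 r_{\gamma_t,l_t}$ if $t\in T(\mathbf{w})$ and $\hat r_t(\mathbf{w})=\hat r_{t-1}(\mathbf{w})$ otherwise; $\mathrm{wt}_t(\mathbf{w})=\hat r_t(\mathbf{w})\lambda-\hat r_{t-1}(\mathbf{w})\lambda$ for $1\le t\le m$; $\mathrm{wt}(\mathbf{w},\mathbf{b})=\mathrm{wt}(\mathbf{w})=\hat r_m(\mathbf{w})\lambda\in P$; - $\deg(\mathbf{w},\mathbf{b})=\frac12\langle\mathrm{qwt}(\mathbf{w},\mathbf{b}),\mathrm{qwt}^\vee(\mathbf{w},\mathbf{b})\rangle+\sum_{t=1}^m\langle\mathrm{wt}_t(\mathbf{w}),\mathrm{qwt}_t^\vee(\mathbf{w},\mathbf{b})\rangle-\sum_{t\in T^-(\mathbf{w})}\mathrm{sgn}(\gamma_t)l_t'-\sum_{t\in S(\mathbf{w})}\mathbf{b}(t)l_t'$. *)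

theory Defs
  imports "HOL-Analysis.Analysis" "HOL-Library.FuncSet"
begin

text \<open>
  The group enters only through its root datum. The type \<open>'a\<close> is the real span of the weight
  lattice, with a Weyl-group-invariant inner product, and its dual is identified with \<open>'a\<close> by that
  inner product: the pairing of \<open>\<nu>\<close> with \<open>h\<close> is \<open>\<nu> \<bullet> h\<close>. Coroots therefore live in the same
  type as roots, but the two are kept apart (no normalisation of the root length is imposed).
\<close>

definition coroot :: "'a::euclidean_space \<Rightarrow> 'a" where
  "coroot \<alpha> = (2 / (\<alpha> \<bullet> \<alpha>)) *\<^sub>R \<alpha>"

definition refl :: "'a::euclidean_space \<Rightarrow> 'a \<Rightarrow> 'a" where
  "refl \<alpha> \<nu> = \<nu> - (\<nu> \<bullet> coroot \<alpha>) *\<^sub>R \<alpha>"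

definition root_system :: "'a::euclidean_space set \<Rightarrow> bool" where
  "root_system \<Delta> \<longleftrightarrow>
     finite \<Delta> \<and> 0 \<notin> \<Delta> \<and> span \<Delta> = UNIV \<and>
     (\<forall>\<alpha>\<in>\<Delta>. refl \<alpha> ` \<Delta> = \<Delta>) \<and>
     (\<forall>\<alpha>\<in>\<Delta>. \<forall>\<beta>\<in>\<Delta>. \<beta> \<bullet> coroot \<alpha> \<in> \<int>) \<and>
     (\<forall>\<alpha>\<in>\<Delta>. \<forall>c. c *\<^sub>R \<alpha> \<in> \<Delta> \<longrightarrow> c = 1 \<or> c = -1)"

definition irreducible_roots :: "'a::euclidean_space set \<Rightarrow> bool" where
  "irreducible_roots \<Delta> \<longleftrightarrow> \<Delta> \<noteq> {} \<and>
     \<not> (\<exists>\<Delta>1 \<Delta>2. \<Delta>1 \<noteq> {} \<and> \<Delta>2 \<noteq> {} \<and> \<Delta>1 \<union> \<Delta>2 = \<Delta> \<and> \<Delta>1 \<inter> \<Delta>2 = {} \<and>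
          (\<forall>\<alpha>\<in>\<Delta>1. \<forall>\<beta>\<in>\<Delta>2. \<alpha> \<bullet> \<beta> = 0))"

text \<open>Used for irreducible root systems, where simply-laced means that there is one root length.\<close>

definition simply_laced :: "'a::euclidean_space set \<Rightarrow> bool" where
  "simply_laced \<Delta> \<longleftrightarrow> (\<forall>\<alpha>\<in>\<Delta>. \<forall>\<beta>\<in>\<Delta>. norm \<alpha> = norm \<beta>)"

text \<open>The choice of positive roots is given by the set \<open>B\<close> of simple roots.\<close>

definition pos_roots :: "'a::euclidean_space set \<Rightarrow> 'a set \<Rightarrow> 'a set" where
  "pos_roots \<Delta> B = {\<alpha> \<in> \<Delta>. \<exists>c :: 'a \<Rightarrow> nat. \<alpha> = (\<Sum>\<beta>\<in>B. real (c \<beta>) *\<^sub>R \<beta>)}"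

definition root_base :: "'a::euclidean_space set \<Rightarrow> 'a set \<Rightarrow> bool" where
  "root_base \<Delta> B \<longleftrightarrow> B \<subseteq> \<Delta> \<and> independent B \<and> \<Delta> = pos_roots \<Delta> B \<union> uminus ` pos_roots \<Delta> B"

text \<open>Bourbaki labelling of the Dynkin diagram: the chain 1-3-4-5-6-7-8, with 2 attached to 4.\<close>

definition type_E8 :: "'a::euclidean_space set \<Rightarrow> bool" where
  "type_E8 B \<longleftrightarrow> (\<exists>a :: nat \<Rightarrow> 'a. bij_betw a {1..8} B \<and>
     (\<forall>i\<in>{1..8}. \<forall>j\<in>{1..8}.
        a i \<bullet> coroot (a j) =
          (if i = j then 2
           else if {i, j} \<in> {{1,3},{3,4},{4,5},{5,6},{6,7},{7,8},{2,4}} then -1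
           else 0)))"

text \<open>The group is simply connected, so its weights are all integral weights.\<close>

definition weight_lattice :: "'a::euclidean_space set \<Rightarrow> 'a set" where
  "weight_lattice \<Delta> = {\<nu>. \<forall>\<alpha>\<in>\<Delta>. \<nu> \<bullet> coroot \<alpha> \<in> \<int>}"

definition root_sgn :: "'a::euclidean_space set \<Rightarrow> 'a set \<Rightarrow> 'a \<Rightarrow> real" where
  "root_sgn \<Delta> B \<alpha> = (if \<alpha> \<in> pos_roots \<Delta> B then 1 else -1)"

definition root_abs :: "'a::euclidean_space set \<Rightarrow> 'a set \<Rightarrow> 'a \<Rightarrow> 'a" where
  "root_abs \<Delta> B \<alpha> = root_sgn \<Delta> B \<alpha> *\<^sub>R \<alpha>"

definition rho :: "'a::euclidean_space set \<Rightarrow> 'a set \<Rightarrow> 'a" where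
  "rho \<Delta> B = (1 / 2) *\<^sub>R (\<Sum>\<alpha>\<in>pos_roots \<Delta> B. \<alpha>)"

text \<open>
  Weyl group elements are maps on \<open>'a\<close>; the product is composition and the inverse is \<open>inv\<close>.
  Reflections are involutions, so they generate the group already as a monoid.
\<close>

inductive_set weyl :: "'a::euclidean_space set \<Rightarrow> ('a \<Rightarrow> 'a) set" for \<Delta> where
  weyl_id: "id \<in> weyl \<Delta>"
| weyl_refl: "\<alpha> \<in> \<Delta> \<Longrightarrow> w \<in> weyl \<Delta> \<Longrightarrow> refl \<alpha> \<circ> w \<in> weyl \<Delta>"

definition weyl_length :: "'a::euclidean_space set \<Rightarrow> ('a \<Rightarrow> 'a) \<Rightarrow> nat" where
  "weyl_length B w =
     (LEAST n. \<exists>\<beta>s. length \<beta>s = n \<and> set \<beta>s \<subseteq> B \<and> w = foldr (\<lambda>\<beta> v. refl \<beta> \<circ> v) \<beta>s id)"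

text \<open>\<open>bruhat_less \<Delta> B x y\<close> is \<open>x < y\<close>.\<close>

definition bruhat_less ::
    "'a::euclidean_space set \<Rightarrow> 'a set \<Rightarrow> ('a \<Rightarrow> 'a) \<Rightarrow> ('a \<Rightarrow> 'a) \<Rightarrow> bool" where
  "bruhat_less \<Delta> B =
     (\<lambda>x y. x \<in> weyl \<Delta> \<and> (\<exists>\<alpha>\<in>pos_roots \<Delta> B. y = x \<circ> refl \<alpha>) \<and>
            weyl_length B x < weyl_length B y)\<^sup>+\<^sup>+"

definition qbg_edge ::
    "'a::euclidean_space set \<Rightarrow> 'a set \<Rightarrow> ('a \<Rightarrow> 'a) \<Rightarrow> 'a \<Rightarrow> ('a \<Rightarrow> 'a) \<Rightarrow> bool" where
  "qbg_edge \<Delta> B x \<alpha> y \<longleftrightarrow>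
     x \<in> weyl \<Delta> \<and> y \<in> weyl \<Delta> \<and> \<alpha> \<in> pos_roots \<Delta> B \<and> y = x \<circ> refl \<alpha> \<and>
     (weyl_length B y = weyl_length B x + 1 \<or>
      real (weyl_length B y) = real (weyl_length B x) - 2 * (rho \<Delta> B \<bullet> coroot \<alpha>) + 1)"

definition hyperplane :: "'a::euclidean_space \<Rightarrow> int \<Rightarrow> 'a set" where
  "hyperplane \<alpha> k = {\<nu>. \<nu> \<bullet> coroot \<alpha> = of_int k}"

definition aff_refl :: "'a::euclidean_space \<Rightarrow> int \<Rightarrow> 'a \<Rightarrow> 'a" where
  "aff_refl \<alpha> k \<nu> = refl \<alpha> \<nu> + of_int k *\<^sub>R \<alpha>"

definition alcoves :: "'a::euclidean_space set \<Rightarrow> 'a set set" where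
  "alcoves \<Delta> = components (- (\<Union>\<alpha>\<in>\<Delta>. \<Union>k. hyperplane \<alpha> k))"

definition fund_alcove :: "'a::euclidean_space set \<Rightarrow> 'a set \<Rightarrow> 'a set" where
  "fund_alcove \<Delta> B = {\<nu>. \<forall>\<alpha>\<in>pos_roots \<Delta> B. 0 < \<nu> \<bullet> coroot \<alpha> \<and> \<nu> \<bullet> coroot \<alpha> < 1}"

text \<open>
  \<open>alcove_step \<Delta> A \<alpha> k A'\<close>: the alcoves \<open>A\<close> and \<open>A'\<close> are adjacent, their common wall
  \<open>closure A \<inter> closure A'\<close> spans \<open>hyperplane \<alpha> k\<close> (hence has codimension one and is
  orthogonal to \<open>\<alpha>\<close>), and \<open>\<alpha>\<close> points from \<open>A\<close> to \<open>A'\<close>.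
\<close>

definition alcove_step ::
    "'a::euclidean_space set \<Rightarrow> 'a set \<Rightarrow> 'a \<Rightarrow> int \<Rightarrow> 'a set \<Rightarrow> bool" where
  "alcove_step \<Delta> A \<alpha> k A' \<longleftrightarrow>
     A \<in> alcoves \<Delta> \<and> A' \<in> alcoves \<Delta> \<and> A \<noteq> A' \<and> \<alpha> \<in> \<Delta> \<and>
     affine hull (closure A \<inter> closure A') = hyperplane \<alpha> k \<and>
     (\<forall>\<nu>\<in>A. \<nu> \<bullet> coroot \<alpha> < of_int k) \<and> (\<forall>\<nu>\<in>A'. of_int k < \<nu> \<bullet> coroot \<alpha>)"

text \<open>
  A path carries, besides the roots \<open>\<gamma>\<^sub>1, \<dots>, \<gamma>\<^sub>m\<close>, the alcoves \<open>A\<^sub>0, \<dots>, A\<^sub>m\<close> and the levels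
  \<open>l\<^sub>1, \<dots>, l\<^sub>m\<close>; both are determined by the roots and the starting alcove.
  The weight at which the path ends is called \<open>\<mu>\<close>, because lambda is reserved syntax.
\<close>

record 'a path_data =
  path_alcoves :: "'a set list"
  path_roots :: "'a list"
  path_levels :: "int list"

definition path_len :: "'a path_data \<Rightarrow> nat" where
  "path_len \<Gamma> = length (path_roots \<Gamma>)"

text \<open>Steps are numbered from 1, list positions from 0.\<close>

definition step_root :: "'a path_data \<Rightarrow> nat \<Rightarrow> 'a" where
  "step_root \<Gamma> t = path_roots \<Gamma> ! (t - 1)"

definition step_level :: "'a path_data \<Rightarrow> nat \<Rightarrow> int" where
  "step_level \<Gamma> t = path_levels \<Gamma> ! (t - 1)"

definition alcove_path ::
    "'a::euclidean_space set \<Rightarrow> 'a set \<Rightarrow> 'a \<Rightarrow> 'a path_data \<Rightarrow> bool" where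
  "alcove_path \<Delta> B \<mu> \<Gamma> \<longleftrightarrow>
     length (path_alcoves \<Gamma>) = path_len \<Gamma> + 1 \<and> length (path_levels \<Gamma>) = path_len \<Gamma> \<and>
     path_alcoves \<Gamma> ! 0 = fund_alcove \<Delta> B \<and>
     path_alcoves \<Gamma> ! path_len \<Gamma> = (\<lambda>\<nu>. \<nu> + \<mu>) ` fund_alcove \<Delta> B \<and>
     (\<forall>t\<in>{1..path_len \<Gamma>}.
        alcove_step \<Delta> (path_alcoves \<Gamma> ! (t - 1)) (step_root \<Gamma> t) (step_level \<Gamma> t)
          (path_alcoves \<Gamma> ! t))"

definition deletion :: "'a::euclidean_space set \<Rightarrow> 'a path_data \<Rightarrow> 'a path_data \<Rightarrow> bool" where
  "deletion \<Delta> \<Gamma> \<Xi> \<longleftrightarrow>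
     (\<exists>us \<alpha> vs. \<alpha> \<in> \<Delta> \<and> path_roots \<Gamma> = us @ [\<alpha>, - \<alpha>] @ vs \<and> path_roots \<Xi> = us @ vs)"

text \<open>\<open>l\<^sub>t' = \<langle>\<mu>, \<gamma>\<^sub>t\<^sup>\<or>\<rangle> - l\<^sub>t\<close>\<close>

definition colevel :: "'a::euclidean_space \<Rightarrow> 'a path_data \<Rightarrow> nat \<Rightarrow> real" where
  "colevel \<mu> \<Gamma> t = \<mu> \<bullet> coroot (step_root \<Gamma> t) - of_int (step_level \<Gamma> t)"

text \<open>A walk \<open>(w\<^sub>0, \<dots>, w\<^sub>m)\<close> is the list \<open>ws\<close> with \<open>ws ! t = w\<^sub>t\<close>.\<close>

definition QW ::
    "'a::euclidean_space set \<Rightarrow> 'a set \<Rightarrow> ('a \<Rightarrow> 'a) \<Rightarrow> 'a path_data \<Rightarrow> ('a \<Rightarrow> 'a) list set" where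
  "QW \<Delta> B w \<Gamma> = {ws.
     length ws = path_len \<Gamma> + 1 \<and> set ws \<subseteq> weyl \<Delta> \<and> ws ! 0 = w \<and>
     (\<forall>t\<in>{1..path_len \<Gamma>}.
        ws ! t \<in> {ws ! (t - 1), refl (step_root \<Gamma> t) \<circ> ws ! (t - 1)} \<and>
        (ws ! t = refl (step_root \<Gamma> t) \<circ> ws ! (t - 1) \<longrightarrow>
           (\<exists>\<alpha>. qbg_edge \<Delta> B (ws ! (t - 1)) \<alpha> (ws ! t))))}"

definition Tset :: "'a::euclidean_space path_data \<Rightarrow> ('a \<Rightarrow> 'a) list \<Rightarrow> nat set" where
  "Tset \<Gamma> ws = {t \<in> {1..path_len \<Gamma>}. ws ! t = refl (step_root \<Gamma> t) \<circ> ws ! (t - 1)}"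

definition Tminus ::
    "'a::euclidean_space set \<Rightarrow> 'a set \<Rightarrow> 'a path_data \<Rightarrow> ('a \<Rightarrow> 'a) list \<Rightarrow> nat set" where
  "Tminus \<Delta> B \<Gamma> ws = {t \<in> {1..path_len \<Gamma>}. bruhat_less \<Delta> B (ws ! t) (ws ! (t - 1))}"

definition Sset ::
    "'a::euclidean_space set \<Rightarrow> 'a path_data \<Rightarrow> ('a \<Rightarrow> 'a) list \<Rightarrow> nat set" where
  "Sset B \<Gamma> ws =
     {t \<in> {1..path_len \<Gamma>}. ws ! t = ws ! (t - 1) \<and> - inv (ws ! t) (step_root \<Gamma> t) \<in> B}"

type_synonym 'a decorated_walk = "('a \<Rightarrow> 'a) list \<times> (nat \<Rightarrow> nat)"

text \<open>A decoration is a function on \<open>Sset\<close>, represented extensionally.\<close>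

definition QWt ::
    "'a::euclidean_space set \<Rightarrow> 'a set \<Rightarrow> ('a \<Rightarrow> 'a) \<Rightarrow> 'a path_data \<Rightarrow>
     'a decorated_walk set" where
  "QWt \<Delta> B w \<Gamma> = {(ws, b). ws \<in> QW \<Delta> B w \<Gamma> \<and> b \<in> Sset B \<Gamma> ws \<rightarrow>\<^sub>E {0, 1}}"

definition walk_end :: "'a path_data \<Rightarrow> 'a decorated_walk \<Rightarrow> 'a \<Rightarrow> 'a" where
  "walk_end \<Gamma> = (\<lambda>(ws, b). ws ! path_len \<Gamma>)"

definition walk_sign ::
    "'a::euclidean_space set \<Rightarrow> 'a set \<Rightarrow> 'a path_data \<Rightarrow> 'a decorated_walk \<Rightarrow> int" where
  "walk_sign \<Delta> B \<Gamma> = (\<lambda>(ws, b).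
     (\<Prod>t | t \<in> Tset \<Gamma> ws \<and> inv (ws ! (t - 1)) (step_root \<Gamma> t) \<in> pos_roots \<Delta> B. -1) *
     (\<Prod>t\<in>Sset B \<Gamma> ws. (-1) ^ b t))"

definition qwt_upto ::
    "'a::euclidean_space set \<Rightarrow> 'a set \<Rightarrow> 'a path_data \<Rightarrow> 'a decorated_walk \<Rightarrow> nat \<Rightarrow> 'a" where
  "qwt_upto \<Delta> B \<Gamma> = (\<lambda>(ws, b) t.
     (\<Sum>u | u \<le> t \<and> u \<in> Tminus \<Delta> B \<Gamma> ws. root_abs \<Delta> B (inv (ws ! u) (step_root \<Gamma> u))) -
     (\<Sum>u | u \<le> t \<and> u \<in> Sset B \<Gamma> ws. real (b u) *\<^sub>R inv (ws ! u) (step_root \<Gamma> u)))"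

definition qwt ::
    "'a::euclidean_space set \<Rightarrow> 'a set \<Rightarrow> 'a path_data \<Rightarrow> 'a decorated_walk \<Rightarrow> 'a" where
  "qwt \<Delta> B \<Gamma> p = qwt_upto \<Delta> B \<Gamma> p (path_len \<Gamma>)"

definition qwt_co_upto ::
    "'a::euclidean_space set \<Rightarrow> 'a set \<Rightarrow> 'a path_data \<Rightarrow> 'a decorated_walk \<Rightarrow> nat \<Rightarrow> 'a" where
  "qwt_co_upto \<Delta> B \<Gamma> = (\<lambda>(ws, b) t.
     (\<Sum>u | u \<le> t \<and> u \<in> Tminus \<Delta> B \<Gamma> ws.
        coroot (root_abs \<Delta> B (inv (ws ! u) (step_root \<Gamma> u)))) -
     (\<Sum>u | u \<le> t \<and> u \<in> Sset B \<Gamma> ws.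
        real (b u) *\<^sub>R inv (ws ! u) (coroot (step_root \<Gamma> u))))"

definition qwt_co ::
    "'a::euclidean_space set \<Rightarrow> 'a set \<Rightarrow> 'a path_data \<Rightarrow> 'a decorated_walk \<Rightarrow> 'a" where
  "qwt_co \<Delta> B \<Gamma> p = qwt_co_upto \<Delta> B \<Gamma> p (path_len \<Gamma>)"

primrec rhat :: "'a::euclidean_space path_data \<Rightarrow> ('a \<Rightarrow> 'a) list \<Rightarrow> nat \<Rightarrow> 'a \<Rightarrow> 'a" where
  "rhat \<Gamma> ws 0 = inv (ws ! 0)"
| "rhat \<Gamma> ws (Suc t) =
     (if Suc t \<in> Tset \<Gamma> ws
      then rhat \<Gamma> ws t \<circ> aff_refl (step_root \<Gamma> (Suc t)) (step_level \<Gamma> (Suc t))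
      else rhat \<Gamma> ws t)"

definition wt_step ::
    "'a::euclidean_space \<Rightarrow> 'a path_data \<Rightarrow> ('a \<Rightarrow> 'a) list \<Rightarrow> nat \<Rightarrow> 'a" where
  "wt_step \<mu> \<Gamma> ws t = rhat \<Gamma> ws t \<mu> - rhat \<Gamma> ws (t - 1) \<mu>"

definition wt :: "'a::euclidean_space \<Rightarrow> 'a path_data \<Rightarrow> 'a decorated_walk \<Rightarrow> 'a" where
  "wt \<mu> \<Gamma> = (\<lambda>(ws, b). rhat \<Gamma> ws (path_len \<Gamma>) \<mu>)"

definition deg ::
    "'a::euclidean_space set \<Rightarrow> 'a set \<Rightarrow> 'a \<Rightarrow> 'a path_data \<Rightarrow> 'a decorated_walk \<Rightarrow> real" where
  "deg \<Delta> B \<mu> \<Gamma> = (\<lambda>(ws, b).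
     (1 / 2) * (qwt \<Delta> B \<Gamma> (ws, b) \<bullet> qwt_co \<Delta> B \<Gamma> (ws, b)) +
     (\<Sum>t = 1..path_len \<Gamma>. wt_step \<mu> \<Gamma> ws t \<bullet> qwt_co_upto \<Delta> B \<Gamma> (ws, b) t) -
     (\<Sum>t\<in>Tminus \<Delta> B \<Gamma> ws. root_sgn \<Delta> B (step_root \<Gamma> t) * colevel \<mu> \<Gamma> t) -
     (\<Sum>t\<in>Sset B \<Gamma> ws. real (b t) * colevel \<mu> \<Gamma> t))"

end

theory Submission
  imports Defs
begin

text \<open>
  Let the deleted segment be the steps \<open>n+1, n+2\<close> with roots \<open>\<alpha>, -\<alpha>\<close>. The path crosses a
  hyperplane and comes straight back through it, so the two levels are opposite, say \<open>k\<close> and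
  \<open>-k\<close>, and the levels of all other steps are the same for both paths (\<open>deletion_levels\<close>).

  Hence only what a walk does during these two steps matters. Let \<open>x\<close> be its position before them,
  \<open>y = s\<^sub>\<alpha> x\<close> and \<open>\<beta> = x\<^sup>-\<^sup>1 \<alpha>\<close>. There are four kinds of behaviour.

  \<^item> It stays at \<open>x\<close> twice, with decoration 0. Nothing is contributed, and forgetting the two steps
    gives a walk along the shorter path. These walks form the subset of part (1).

  \<^item> It stays at \<open>x\<close> twice, with decoration 1 at one of the steps. Then \<open>\<beta>\<close> or \<open>-\<beta>\<close> is simple.

  \<^item> It goes to \<open>y\<close> and back to \<open>x\<close>. Then both \<open>x \<rightarrow> y\<close> and \<open>y \<rightarrow> x\<close> are edges of the quantum
    Bruhat graph. One of them raises the length by 1, so the other is a quantum edge which lowers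
    it by 1; this forces \<open>\<langle>\<rho>, |\<beta>|\<^sup>\<or>\<rangle> = 1\<close>, that is, \<open>|\<beta>|\<close> is simple. Conversely, for simple \<open>|\<beta>|\<close>
    both edges exist. So this kind of walk is in bijection with the preceding kind. Both kinds add
    \<open>|\<beta>|\<close> to the quantum weight, and their signs are opposite (\<open>advance2_cross_cross\<close>).

  \<^item> It ends at \<open>y\<close>, crossing either at the first or at the second of the two steps. Exchanging
    the order, with the decoration of the step at which the walk stays carried along, is an involution.
    The sign changes because the crossing counts with \<open>\<beta>\<close> at the first step and with \<open>-\<beta>\<close> at
    the second, and exactly one of them is positive (\<open>advance2_cross_stay\<close>).

  The involution of part (2) exchanges the second kind with the third, and the two orders
  within the fourth. All statistics of a walk can be computed by a left-to-right pass that updates a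
  state. It therefore suffices to compare the states after the two steps; the rest of the
  walk then acts on equal states, up to the sign.

  The Weyl group enters only through the third kind: the pairing of \<open>\<rho>\<close> with a coroot is a
  height, and right multiplication by a simple reflection changes the length by exactly 1, in
  the direction determined by the sign of the image of the simple root (\<open>simple_reflection_edges\<close>).
\<close>

section \<open>Reflections\<close>

lemma coroot_minus [simp]: "coroot (- \<alpha>) = - coroot \<alpha>"
  by (simp add: coroot_def)

lemma inner_coroot_self: "\<alpha> \<noteq> 0 \<Longrightarrow> \<alpha> \<bullet> coroot \<alpha> = 2"
  by (simp add: coroot_def)

lemma refl_minus [simp]: "refl (- \<alpha>) = refl \<alpha>"
  by (simp add: refl_def fun_eq_iff)

lemma linear_refl: "linear (refl \<alpha>)"
  by (rule linearI) (simp_all add: refl_def inner_add_left algebra_simps)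

lemma refl_self: "\<alpha> \<noteq> 0 \<Longrightarrow> refl \<alpha> \<alpha> = - \<alpha>"
  by (simp add: refl_def inner_coroot_self scaleR_2)

lemma refl_refl [simp]: "refl \<alpha> (refl \<alpha> \<nu>) = \<nu>"
  by (cases "\<alpha> = 0") (simp_all add: refl_def inner_diff_left inner_coroot_self algebra_simps)

lemma inner_refl_refl: "refl \<alpha> u \<bullet> refl \<alpha> v = u \<bullet> v"
proof (cases "\<alpha> = 0")
  case False
  then have n: "\<alpha> \<bullet> \<alpha> \<noteq> 0" by simp
  show ?thesis
    using n by (simp add: refl_def coroot_def inner_diff_left inner_diff_right inner_commute
        field_simps)
qed (simp add: refl_def)

lemma aff_refl_minus: "aff_refl (- \<alpha>) (- k) = aff_refl \<alpha> k"
  by (simp add: aff_refl_def fun_eq_iff)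

lemma aff_refl_aff_refl [simp]: "\<alpha> \<noteq> 0 \<Longrightarrow> aff_refl \<alpha> k (aff_refl \<alpha> k \<nu>) = \<nu>"
  using linear_add[OF linear_refl, of \<alpha>] linear_scale[OF linear_refl, of \<alpha>]
  by (simp add: aff_refl_def refl_self)

lemma aff_refl_add: "aff_refl \<alpha> k (\<nu> + \<delta>) = aff_refl \<alpha> k \<nu> + refl \<alpha> \<delta>"
  by (simp add: aff_refl_def linear_add[OF linear_refl])

lemma refl_isometry_image:
  assumes "linear f" and iso: "\<And>u v. f u \<bullet> f v = u \<bullet> v"
  shows "f (refl \<gamma> v) = refl (f \<gamma>) (f v)"
    and "coroot (f \<gamma>) = f (coroot \<gamma>)"
proof -
  show "coroot (f \<gamma>) = f (coroot \<gamma>)"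
    by (simp add: coroot_def iso linear_scale[OF assms(1)])
  then show "f (refl \<gamma> v) = refl (f \<gamma>) (f v)"
    by (simp add: refl_def iso linear_diff[OF assms(1)] linear_scale[OF assms(1)])
qed

lemma root_system_minus:
  assumes "root_system \<Delta>" and "\<beta> \<in> \<Delta>"
  shows "- \<beta> \<in> \<Delta>"
proof -
  have "\<beta> \<noteq> 0" and "refl \<beta> ` \<Delta> = \<Delta>" using assms by (auto simp: root_system_def)
  then show ?thesis using refl_self[of \<beta>] assms(2) by (metis imageI)
qed

section \<open>The levels of an alcove path\<close>

text \<open>
  An alcove lies, for each root, in one open strip between consecutive parallel hyperplanes. A
  step with root \<open>\<gamma>\<close> moves between neighbouring strips of \<open>\<gamma>\<close> and \<open>-\<gamma>\<close> and changes no other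
  strip. So the strips of all alcoves of a path, and with them the levels, can be read off from
  its roots.
\<close>

text \<open>
  The value 0 off the root system makes the strips of an alcove a total function, so that the effect
  of a step is an equation between functions.
\<close>
definition strip :: "'a::euclidean_space set \<Rightarrow> 'a set \<Rightarrow> 'a \<Rightarrow> int" where
  "strip \<Delta> A \<beta> = (if \<beta> \<in> \<Delta> then \<lfloor>(SOME \<nu>. \<nu> \<in> A) \<bullet> coroot \<beta>\<rfloor> else 0)"

lemma alcove_nonempty: "A \<in> alcoves \<Delta> \<Longrightarrow> A \<noteq> {}"
  unfolding alcoves_def by (rule in_components_nonempty)

text \<open>
  A component of the complement is connected, and the pairing with a coroot takes no integer
  value on it.
\<close>
lemma alcove_in_strip:
  assumes A: "A \<in> alcoves \<Delta>" and b: "\<beta> \<in> \<Delta>" and n: "\<nu> \<in> A"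
  shows "strip \<Delta> A \<beta> < \<nu> \<bullet> coroot \<beta>" and "\<nu> \<bullet> coroot \<beta> < strip \<Delta> A \<beta> + 1"
proof -
  define \<nu>0 where "\<nu>0 = (SOME \<nu>. \<nu> \<in> A)"
  have n0: "\<nu>0 \<in> A" unfolding \<nu>0_def using n by (rule someI)
  let ?S = "(\<lambda>\<nu>. \<nu> \<bullet> coroot \<beta>) ` A"
  have conn: "connected ?S"
    using in_components_connected[OF A[unfolded alcoves_def]]
    by (intro connected_continuous_image continuous_intros)
  have off: "of_int k \<notin> ?S" for k
  proof
    assume "of_int k \<in> ?S"
    then obtain \<nu> where "\<nu> \<in> A" "\<nu> \<in> hyperplane \<beta> k" by (auto simp: hyperplane_def)
    then show False using in_components_subset[OF A[unfolded alcoves_def]] b by blast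
  qed
  have f: "strip \<Delta> A \<beta> = \<lfloor>\<nu>0 \<bullet> coroot \<beta>\<rfloor>" using b by (simp add: strip_def \<nu>0_def)
  have m: "\<nu>0 \<bullet> coroot \<beta> \<in> ?S" "\<nu> \<bullet> coroot \<beta> \<in> ?S" using n0 n by auto
  show "strip \<Delta> A \<beta> < \<nu> \<bullet> coroot \<beta>"
  proof (rule ccontr)
    assume "\<not> ?thesis"
    then have "of_int (strip \<Delta> A \<beta>) \<in> ?S"
      using connectedD_interval[OF conn m(2) m(1)] f by auto
    then show False using off by blast
  qed
  show "\<nu> \<bullet> coroot \<beta> < strip \<Delta> A \<beta> + 1"
  proof (rule ccontr)
    assume "\<not> ?thesis"
    then have "of_int (strip \<Delta> A \<beta> + 1) \<in> ?S"
      using connectedD_interval[OF conn m(1) m(2), of "of_int (strip \<Delta> A \<beta> + 1)"] f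
      by simp
    then show False using off by blast
  qed
qed

lemma strip_minus:
  assumes A: "A \<in> alcoves \<Delta>" and "\<beta> \<in> \<Delta>" and "- \<beta> \<in> \<Delta>"
  shows "strip \<Delta> A (- \<beta>) = - strip \<Delta> A \<beta> - 1"
proof -
  obtain \<nu> where "\<nu> \<in> A" using alcove_nonempty[OF A] by auto
  from alcove_in_strip[OF A assms(2) this] alcove_in_strip[OF A assms(3) this] show ?thesis
    by simp
qed

lemma closure_alcove_in_strip:
  assumes A: "A \<in> alcoves \<Delta>" and b: "\<beta> \<in> \<Delta>" and n: "\<nu> \<in> closure A"
  shows "strip \<Delta> A \<beta> \<le> \<nu> \<bullet> coroot \<beta>" and "\<nu> \<bullet> coroot \<beta> \<le> strip \<Delta> A \<beta> + 1"
proof -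
  let ?H = "{\<nu>. strip \<Delta> A \<beta> \<le> \<nu> \<bullet> coroot \<beta>} \<inter> {\<nu>. \<nu> \<bullet> coroot \<beta> \<le> strip \<Delta> A \<beta> + 1}"
  have "A \<subseteq> ?H" using alcove_in_strip[OF A b] by (auto simp: less_imp_le)
  moreover have "closed ?H" by (intro closed_Int closed_Collect_le continuous_intros)
  ultimately have "closure A \<subseteq> ?H" by (rule closure_minimal)
  then show "strip \<Delta> A \<beta> \<le> \<nu> \<bullet> coroot \<beta>" and "\<nu> \<bullet> coroot \<beta> \<le> strip \<Delta> A \<beta> + 1"
    using n by auto
qed

text \<open>
  Otherwise the component of \<open>\<beta>\<close> orthogonal to \<open>\<gamma>\<close> is a direction within the first hyperplane
  along which the pairing with \<open>\<beta>\<close> changes.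
\<close>
lemma hyperplane_subset_parallel:
  assumes sub: "hyperplane \<gamma> k \<subseteq> hyperplane \<beta> j" and g: "\<gamma> \<noteq> 0"
  shows "\<exists>c. \<beta> = c *\<^sub>R \<gamma>"
proof -
  \<comment> \<open>a point of the hyperplane, as \<open>\<langle>\<gamma>, \<gamma>\<^sup>\<or>\<rangle> = 2\<close>\<close>
  define p where "p = (of_int k / 2) *\<^sub>R \<gamma>"
  define v where "v = \<beta> - ((\<beta> \<bullet> \<gamma>) / (\<gamma> \<bullet> \<gamma>)) *\<^sub>R \<gamma>"
  have vg: "v \<bullet> \<gamma> = 0" using g by (simp add: v_def inner_diff_left)
  have "p \<in> hyperplane \<gamma> k" "p + v \<in> hyperplane \<gamma> k"
    using g vg by (simp_all add: hyperplane_def p_def coroot_def inner_add_left)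
  then have "p \<in> hyperplane \<beta> j" "p + v \<in> hyperplane \<beta> j" using sub by auto
  then have "v \<bullet> coroot \<beta> = 0" by (simp add: hyperplane_def inner_add_left)
  then have "v \<bullet> \<beta> = 0" by (auto simp: coroot_def)
  then have "v \<bullet> v = 0" using vg by (simp add: v_def inner_diff_right)
  then have "v = 0" by simp
  then show ?thesis by (auto simp: v_def)
qed

text \<open>
  If the strips of \<open>\<beta>\<close> differ, the closures of the two alcoves meet only in a
  hyperplane of \<open>\<beta>\<close>. That hyperplane then contains the one spanned by the common wall, so \<open>\<beta>\<close>
  is proportional to \<open>\<gamma>\<close>.
\<close>
lemma alcove_step_strips:
  assumes rs: "root_system \<Delta>" and step: "alcove_step \<Delta> A \<gamma> k A'"
  shows "k = strip \<Delta> A \<gamma> + 1" and "strip \<Delta> A' \<gamma> = k"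
    and "\<beta> \<in> \<Delta> \<Longrightarrow> \<beta> \<noteq> \<gamma> \<Longrightarrow> \<beta> \<noteq> - \<gamma> \<Longrightarrow> strip \<Delta> A' \<beta> = strip \<Delta> A \<beta>"
proof -
  let ?F = "closure A \<inter> closure A'"
  have A: "A \<in> alcoves \<Delta>" and A': "A' \<in> alcoves \<Delta>" and g: "\<gamma> \<in> \<Delta>"
    and hull: "affine hull ?F = hyperplane \<gamma> k"
    and below: "\<And>\<nu>. \<nu> \<in> A \<Longrightarrow> \<nu> \<bullet> coroot \<gamma> < k" and above: "\<And>\<nu>. \<nu> \<in> A' \<Longrightarrow> k < \<nu> \<bullet> coroot \<gamma>"
    using step by (auto simp: alcove_step_def)
  have nz: "\<gamma> \<noteq> 0" using g rs by (auto simp: root_system_def)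
  have "(of_int k / 2) *\<^sub>R \<gamma> \<in> hyperplane \<gamma> k" using nz by (simp add: hyperplane_def coroot_def)
  then have "?F \<noteq> {}" using hull by (metis affine_hull_empty empty_iff)
  then obtain p where p: "p \<in> ?F" by blast
  have "p \<in> hyperplane \<gamma> k" using p hull hull_inc[of p ?F affine] by simp
  then have pk: "p \<bullet> coroot \<gamma> = k" by (simp add: hyperplane_def)
  obtain \<nu> \<nu>' where n: "\<nu> \<in> A" "\<nu>' \<in> A'"
    using alcove_nonempty[OF A] alcove_nonempty[OF A'] by auto
  have pc: "p \<in> closure A" "p \<in> closure A'" using p by auto
  show "k = strip \<Delta> A \<gamma> + 1"
    using closure_alcove_in_strip(2)[OF A g pc(1)] alcove_in_strip(1)[OF A g n(1)] below[OF n(1)] pk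
    by linarith
  show "strip \<Delta> A' \<gamma> = k"
    using closure_alcove_in_strip(1)[OF A' g pc(2)] alcove_in_strip(2)[OF A' g n(2)] above[OF n(2)] pk
    by linarith
  show "strip \<Delta> A' \<beta> = strip \<Delta> A \<beta>" if b: "\<beta> \<in> \<Delta>" "\<beta> \<noteq> \<gamma>" "\<beta> \<noteq> - \<gamma>"
  proof (rule ccontr)
    assume ne: "strip \<Delta> A' \<beta> \<noteq> strip \<Delta> A \<beta>"
    define j where "j = max (strip \<Delta> A' \<beta>) (strip \<Delta> A \<beta>)"
    have "?F \<subseteq> hyperplane \<beta> j"
    proof
      fix q assume q: "q \<in> ?F"
      then have q: "q \<in> closure A" "q \<in> closure A'" by auto
      note bounds = closure_alcove_in_strip[OF A b(1) q(1)] closure_alcove_in_strip[OF A' b(1) q(2)]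
      have "q \<bullet> coroot \<beta> = of_int j"
      proof (cases "strip \<Delta> A \<beta> < strip \<Delta> A' \<beta>")
        case True
        then have "real_of_int (strip \<Delta> A \<beta>) + 1 \<le> strip \<Delta> A' \<beta>" "j = strip \<Delta> A' \<beta>"
          by (simp_all add: j_def)
        then show ?thesis using bounds by simp
      next
        case False
        then have "real_of_int (strip \<Delta> A' \<beta>) + 1 \<le> strip \<Delta> A \<beta>" "j = strip \<Delta> A \<beta>"
          using ne by (simp_all add: j_def)
        then show ?thesis using bounds by simp
      qed
      then show "q \<in> hyperplane \<beta> j" by (simp add: hyperplane_def)
    qed
    moreover have "affine (hyperplane \<beta> j)"
    proof -
      have "hyperplane \<beta> j = {x. coroot \<beta> \<bullet> x = of_int j}"
        by (auto simp: hyperplane_def inner_commute)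
      then show ?thesis by (simp only: affine_hyperplane)
    qed
    ultimately have "hyperplane \<gamma> k \<subseteq> hyperplane \<beta> j"
      using hull hull_minimal[of ?F "hyperplane \<beta> j" affine] by simp
    then obtain c where c: "\<beta> = c *\<^sub>R \<gamma>" using hyperplane_subset_parallel nz by blast
    have "c = 1 \<or> c = -1" using rs g b(1) c unfolding root_system_def by blast
    then show False using b c by auto
  qed
qed

definition cross :: "'a::euclidean_space \<Rightarrow> ('a \<Rightarrow> int) \<Rightarrow> 'a \<Rightarrow> int" where
  "cross \<gamma> F = F(\<gamma> := F \<gamma> + 1, - \<gamma> := F (- \<gamma>) - 1)"

lemma real_vector_eq_minus: "\<gamma> = - \<gamma> \<longleftrightarrow> (\<gamma> :: 'a::real_vector) = 0"
proof
  assume "\<gamma> = - \<gamma>"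
  then have "2 *\<^sub>R \<gamma> = 0" by (metis add.left_inverse scaleR_2)
  then show "\<gamma> = 0" by simp
qed simp

lemma cross_cross_minus: "\<gamma> \<noteq> 0 \<Longrightarrow> cross (- \<gamma>) (cross \<gamma> F) = F"
  using real_vector_eq_minus[of \<gamma>] by (auto simp: cross_def fun_eq_iff)

lemma alcove_step_cross:
  assumes rs: "root_system \<Delta>" and step: "alcove_step \<Delta> A \<gamma> k A'"
  shows "strip \<Delta> A' = cross \<gamma> (strip \<Delta> A)"
proof
  fix \<beta>
  have A: "A \<in> alcoves \<Delta>" and A': "A' \<in> alcoves \<Delta>" and g: "\<gamma> \<in> \<Delta>"
    using step by (auto simp: alcove_step_def)
  note m = root_system_minus[OF rs g]
  have "\<gamma> \<noteq> 0" using g rs by (auto simp: root_system_def)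
  then have ne: "\<gamma> \<noteq> - \<gamma>" using real_vector_eq_minus by blast
  show "strip \<Delta> A' \<beta> = cross \<gamma> (strip \<Delta> A) \<beta>"
  proof (cases "\<beta> \<in> \<Delta>")
    case True
    then show ?thesis
      using alcove_step_strips[OF rs step] alcove_step_strips(3)[OF rs step True]
        strip_minus[OF A g m] strip_minus[OF A' g m] ne
      by (auto simp: cross_def)
  next
    case False
    then show ?thesis using g m by (auto simp: cross_def strip_def)
  qed
qed

primrec levels :: "('a::euclidean_space \<Rightarrow> int) \<Rightarrow> 'a list \<Rightarrow> int list" where
  "levels F [] = []"
| "levels F (\<gamma> # \<gamma>s) = (F \<gamma> + 1) # levels (cross \<gamma> F) \<gamma>s"

lemma length_levels [simp]: "length (levels F \<gamma>s) = length \<gamma>s"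
  by (induction \<gamma>s arbitrary: F) simp_all

lemma levels_append: "levels F (us @ vs) = levels F us @ levels (fold cross us F) vs"
  by (induction us arbitrary: F) simp_all

lemma nth_levels: "i < length \<gamma>s \<Longrightarrow> levels F \<gamma>s ! i = fold cross (take i \<gamma>s) F (\<gamma>s ! i) + 1"
  by (induction \<gamma>s arbitrary: F i) (auto simp: nth_Cons split: nat.split)

lemma alcove_path_step:
  assumes "alcove_path \<Delta> B \<mu> \<Gamma>" and "i < length (path_roots \<Gamma>)"
  shows "alcove_step \<Delta> (path_alcoves \<Gamma> ! i) (path_roots \<Gamma> ! i) (path_levels \<Gamma> ! i)
    (path_alcoves \<Gamma> ! Suc i)"
  using assms(1)[unfolded alcove_path_def] assms(2)
  by (auto simp: path_len_def step_root_def step_level_def dest!: bspec[where x = "Suc i"])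

lemma alcove_path_strips:
  assumes rs: "root_system \<Delta>" and path: "alcove_path \<Delta> B \<mu> \<Gamma>"
    and "i \<le> length (path_roots \<Gamma>)"
  shows "fold cross (take i (path_roots \<Gamma>)) (strip \<Delta> (fund_alcove \<Delta> B)) =
    strip \<Delta> (path_alcoves \<Gamma> ! i)"
  using assms(3)
proof (induction i)
  case 0
  then show ?case using path by (simp add: alcove_path_def)
next
  case (Suc i)
  then have i: "i < length (path_roots \<Gamma>)" by simp
  from Suc i alcove_step_cross[OF rs alcove_path_step[OF path i]] show ?case
    by (simp add: take_Suc_conv_app_nth)
qed

lemma path_levels_eq:
  assumes rs: "root_system \<Delta>" and path: "alcove_path \<Delta> B \<mu> \<Gamma>"
  shows "path_levels \<Gamma> = levels (strip \<Delta> (fund_alcove \<Delta> B)) (path_roots \<Gamma>)"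
proof (rule nth_equalityI)
  show "length (path_levels \<Gamma>) =
      length (levels (strip \<Delta> (fund_alcove \<Delta> B)) (path_roots \<Gamma>))"
    using path by (simp add: alcove_path_def path_len_def)
  fix i assume "i < length (path_levels \<Gamma>)"
  then have i: "i < length (path_roots \<Gamma>)" using path by (simp add: alcove_path_def path_len_def)
  show "path_levels \<Gamma> ! i = levels (strip \<Delta> (fund_alcove \<Delta> B)) (path_roots \<Gamma>) ! i"
    using alcove_step_strips(1)[OF rs alcove_path_step[OF path i]]
      alcove_path_strips[OF rs path less_imp_le[OF i]] i by (simp add: nth_levels)
qed

text \<open>
  Crossing by \<open>\<alpha>\<close> and then by \<open>-\<alpha>\<close> restores all strips, and the strips of \<open>\<alpha>\<close> and \<open>-\<alpha>\<close>
  have opposite boundaries.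
\<close>
lemma deletion_levels:
  assumes rs: "root_system \<Delta>"
    and G: "alcove_path \<Delta> B \<mu> \<Gamma>" and X: "alcove_path \<Delta> B \<mu> \<Xi>" and a: "\<alpha> \<in> \<Delta>"
    and rG: "path_roots \<Gamma> = us @ [\<alpha>, - \<alpha>] @ vs" and rX: "path_roots \<Xi> = us @ vs"
  obtains ls k ms where "path_levels \<Gamma> = ls @ [k, - k] @ ms" "path_levels \<Xi> = ls @ ms"
    "length ls = length us" "length ms = length vs"
proof -
  let ?S = "strip \<Delta> (fund_alcove \<Delta> B)"
  let ?F = "fold cross us ?S"
  have nz: "\<alpha> \<noteq> 0" using a rs by (auto simp: root_system_def)
  let ?n = "length us"
  have n: "?n < length (path_roots \<Gamma>)" using rG by simp
  let ?A = "path_alcoves \<Gamma> ! ?n"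
  have A: "?A \<in> alcoves \<Delta>" using alcove_path_step[OF G n] by (simp add: alcove_step_def)
  have "?F = strip \<Delta> ?A" using alcove_path_strips[OF rs G, of ?n] rG by simp
  then have F: "?F (- \<alpha>) = - ?F \<alpha> - 1" using strip_minus[OF A a root_system_minus[OF rs a]] by simp
  have two: "levels F' ([\<alpha>, - \<alpha>] @ vs) = [F' \<alpha> + 1, - (F' \<alpha> + 1)] @ levels F' vs"
    if "F' (- \<alpha>) = - F' \<alpha> - 1" for F'
    using that nz real_vector_eq_minus[of \<alpha>]
    by (simp add: cross_cross_minus) (simp add: cross_def)
  have "path_levels \<Gamma> = levels ?S us @ levels ?F ([\<alpha>, - \<alpha>] @ vs)"
    unfolding path_levels_eq[OF rs G] rG levels_append[of _ us] ..
  then have "path_levels \<Gamma> = levels ?S us @ [?F \<alpha> + 1, - (?F \<alpha> + 1)] @ levels ?F vs"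
    unfolding two[OF F] .
  moreover have "path_levels \<Xi> = levels ?S us @ levels ?F vs"
    unfolding path_levels_eq[OF rs X] rX levels_append[of _ us] ..
  ultimately show ?thesis using that[of "levels ?S us" "?F \<alpha> + 1" "levels ?F vs"] by simp
qed

section \<open>Positive roots and the Weyl group\<close>

lemma refl_comp_refl: "refl \<alpha> \<circ> refl \<alpha> = id"
  by (simp add: fun_eq_iff)

lemma refl_comp_refl_comp: "refl \<alpha> \<circ> (refl \<alpha> \<circ> f) = f"
  by (simp add: fun_eq_iff)

primrec word :: "'a::euclidean_space list \<Rightarrow> 'a \<Rightarrow> 'a" where
  "word [] = id"
| "word (\<beta> # \<beta>s) = refl \<beta> \<circ> word \<beta>s"

lemma foldr_word: "foldr (\<lambda>\<beta> v. refl \<beta> \<circ> v) \<beta>s id = word \<beta>s"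
  by (induction \<beta>s) simp_all

lemma weyl_id_mem: "id \<in> weyl \<Delta>"
  by (rule weyl.weyl_id)

lemma weyl_refl_mem: "\<alpha> \<in> \<Delta> \<Longrightarrow> w \<in> weyl \<Delta> \<Longrightarrow> refl \<alpha> \<circ> w \<in> weyl \<Delta>"
  by (rule weyl.weyl_refl)

text \<open>
  Having one root length makes coroots proportional to roots by a common factor, so that positive roots and
  their coroots have the same coefficients over the simple ones.
\<close>
locale based_root_system =
  fixes \<Delta> B :: "'a::euclidean_space set"
  assumes rs: "root_system \<Delta>" and sl: "simply_laced \<Delta>" and base: "root_base \<Delta> B"
begin

abbreviation "Pos \<equiv> pos_roots \<Delta> B"
abbreviation "len \<equiv> weyl_length B"

lemma B_sub: "B \<subseteq> \<Delta>" and indep_B: "independent B"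
  and roots_split: "\<Delta> = Pos \<union> uminus ` Pos"
  using base by (auto simp: root_base_def)

lemma finite_\<Delta>: "finite \<Delta>" using rs by (simp add: root_system_def)
lemma finite_B: "finite B" using finite_\<Delta> B_sub finite_subset by blast
lemma root_nz: "\<alpha> \<in> \<Delta> \<Longrightarrow> \<alpha> \<noteq> 0" using rs by (auto simp: root_system_def)
lemma refl_root: "\<alpha> \<in> \<Delta> \<Longrightarrow> \<beta> \<in> \<Delta> \<Longrightarrow> refl \<alpha> \<beta> \<in> \<Delta>"
  using rs unfolding root_system_def by blast
lemma root_int: "\<alpha> \<in> \<Delta> \<Longrightarrow> \<beta> \<in> \<Delta> \<Longrightarrow> \<beta> \<bullet> coroot \<alpha> \<in> \<int>"
  using rs unfolding root_system_def by blast
lemma root_sq: "\<alpha> \<in> \<Delta> \<Longrightarrow> \<beta> \<in> \<Delta> \<Longrightarrow> \<alpha> \<bullet> \<alpha> = \<beta> \<bullet> \<beta>"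
proof -
  assume "\<alpha> \<in> \<Delta>" "\<beta> \<in> \<Delta>"
  then have "norm \<alpha> = norm \<beta>" using sl unfolding simply_laced_def by blast
  then show ?thesis by (simp add: norm_eq)
qed
lemma root_multiple: "\<alpha> \<in> \<Delta> \<Longrightarrow> c *\<^sub>R \<alpha> \<in> \<Delta> \<Longrightarrow> c = 1 \<or> c = -1"
  using rs unfolding root_system_def by blast
lemma minus_root: "\<alpha> \<in> \<Delta> \<Longrightarrow> - \<alpha> \<in> \<Delta>"
  using root_system_minus rs .
lemma Pos_sub: "Pos \<subseteq> \<Delta>" by (auto simp: pos_roots_def)
lemma finite_Pos: "finite Pos" using Pos_sub finite_\<Delta> finite_subset by blast

lemma comb_unique:
  assumes "(\<Sum>\<beta>\<in>B. c \<beta> *\<^sub>R \<beta>) = (\<Sum>\<beta>\<in>B. d \<beta> *\<^sub>R \<beta>)" and "\<beta> \<in> B"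
  shows "c \<beta> = d \<beta>"
proof -
  have "(\<Sum>\<beta>\<in>B. (c \<beta> - d \<beta>) *\<^sub>R \<beta>) = 0"
    using assms(1) by (simp add: scaleR_left_diff_distrib sum_subtractf)
  then show ?thesis
    using indep_B assms(2) independentD[OF indep_B finite_B, of "\<lambda>\<beta>. c \<beta> - d \<beta>"] by auto
qed

lemma pos_coeffs:
  assumes "\<gamma> \<in> Pos"
  obtains c :: "'a \<Rightarrow> nat" where "\<gamma> = (\<Sum>\<beta>\<in>B. real (c \<beta>) *\<^sub>R \<beta>)"
  using assms by (auto simp: pos_roots_def)

lemma not_pos_minus: "\<gamma> \<in> Pos \<Longrightarrow> - \<gamma> \<notin> Pos"
proof
  assume g: "\<gamma> \<in> Pos" and m: "- \<gamma> \<in> Pos"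
  obtain c where c: "\<gamma> = (\<Sum>\<beta>\<in>B. real (c \<beta>) *\<^sub>R \<beta>)" using pos_coeffs[OF g] .
  obtain d where d: "- \<gamma> = (\<Sum>\<beta>\<in>B. real (d \<beta>) *\<^sub>R \<beta>)" using pos_coeffs[OF m] .
  have "\<gamma> = (\<Sum>\<beta>\<in>B. (- real (d \<beta>)) *\<^sub>R \<beta>)"
    using arg_cong[OF d, of uminus] by (simp add: sum_negf)
  then have "real (c \<beta>) = - real (d \<beta>)" if "\<beta> \<in> B" for \<beta>
    using comb_unique[of "\<lambda>\<beta>. real (c \<beta>)" "\<lambda>\<beta>. - real (d \<beta>)" \<beta>] c that by simp
  then have z: "real (c \<beta>) = 0" if "\<beta> \<in> B" for \<beta> using that
    by (metis add_nonneg_eq_0_iff eq_neg_iff_add_eq_0 of_nat_0_le_iff)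
  have "\<gamma> = 0" unfolding c by (rule sum.neutral) (simp add: z)
  then show False using g Pos_sub root_nz by blast
qed

lemma pos_minus_iff: "\<gamma> \<in> \<Delta> \<Longrightarrow> - \<gamma> \<in> Pos \<longleftrightarrow> \<gamma> \<notin> Pos"
  using roots_split not_pos_minus[of \<gamma>] not_pos_minus[of "- \<gamma>"] by fastforce

lemma root_sgn_minus: "\<gamma> \<in> \<Delta> \<Longrightarrow> root_sgn \<Delta> B (- \<gamma>) = - root_sgn \<Delta> B \<gamma>"
  by (simp add: root_sgn_def pos_minus_iff)

lemma root_abs_minus: "\<gamma> \<in> \<Delta> \<Longrightarrow> root_abs \<Delta> B (- \<gamma>) = root_abs \<Delta> B \<gamma>"
  by (simp add: root_abs_def root_sgn_minus)

lemma simple_pos: "B \<subseteq> Pos"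
proof
  fix \<beta> assume b: "\<beta> \<in> B"
  have "(\<Sum>\<gamma>\<in>B. real (if \<gamma> = \<beta> then 1 else 0) *\<^sub>R \<gamma>) = (\<Sum>\<gamma>\<in>B. if \<gamma> = \<beta> then \<gamma> else 0)"
    by (rule sum.cong) auto
  also have "\<dots> = \<beta>" using b finite_B by simp
  finally show "\<beta> \<in> Pos" using b B_sub unfolding pos_roots_def
    by (auto intro!: exI[of _ "\<lambda>\<gamma>. if \<gamma> = \<beta> then 1 else 0"])
qed

text \<open>
  The reflection changes only the coefficient of \<open>\<beta>\<close>. Some other coefficient of \<open>\<gamma>\<close> is
  positive, since no multiple of \<open>\<beta>\<close> other than \<open>\<beta>\<close> is a positive root.
\<close>
lemma refl_simple_pos:
  assumes b: "\<beta> \<in> B" and g: "\<gamma> \<in> Pos" and ne: "\<gamma> \<noteq> \<beta>"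
  shows "refl \<beta> \<gamma> \<in> Pos"
proof (rule ccontr)
  assume n: "refl \<beta> \<gamma> \<notin> Pos"
  have gD: "\<gamma> \<in> \<Delta>" and bD: "\<beta> \<in> \<Delta>" using g Pos_sub b B_sub by auto
  then have "- refl \<beta> \<gamma> \<in> Pos" using n refl_root pos_minus_iff by blast
  then obtain d where d: "- refl \<beta> \<gamma> = (\<Sum>\<delta>\<in>B. real (d \<delta>) *\<^sub>R \<delta>)" using pos_coeffs by blast
  obtain c where c: "\<gamma> = (\<Sum>\<delta>\<in>B. real (c \<delta>) *\<^sub>R \<delta>)" using pos_coeffs[OF g] .
  define n where "n = \<gamma> \<bullet> coroot \<beta>"
  have "refl \<beta> \<gamma> = (\<Sum>\<delta>\<in>B. real (c \<delta>) *\<^sub>R \<delta>) - (\<Sum>\<delta>\<in>B. (if \<delta> = \<beta> then n else 0) *\<^sub>R \<delta>)"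
  proof -
    have "(\<Sum>\<delta>\<in>B. (if \<delta> = \<beta> then n else 0) *\<^sub>R \<delta>) = (\<Sum>\<delta>\<in>B. if \<delta> = \<beta> then n *\<^sub>R \<beta> else 0)"
      by (rule sum.cong) auto
    also have "\<dots> = n *\<^sub>R \<beta>" using b finite_B by simp
    finally show ?thesis using c by (simp add: refl_def n_def)
  qed
  also have "\<dots> = (\<Sum>\<delta>\<in>B. (real (c \<delta>) - (if \<delta> = \<beta> then n else 0)) *\<^sub>R \<delta>)"
    by (simp add: scaleR_left_diff_distrib sum_subtractf)
  finally have e: "(\<Sum>\<delta>\<in>B. (- real (d \<delta>)) *\<^sub>R \<delta>) =
      (\<Sum>\<delta>\<in>B. (real (c \<delta>) - (if \<delta> = \<beta> then n else 0)) *\<^sub>R \<delta>)"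
    using arg_cong[OF d, of uminus] by (simp add: sum_negf)
  have z: "c \<delta> = 0" if "\<delta> \<in> B" "\<delta> \<noteq> \<beta>" for \<delta>
    using comb_unique[OF e that(1)] that(2) by simp
  \<comment> \<open>Comparing coefficients of opposite signs leaves only a multiple of \<open>\<beta>\<close>.\<close>
  have "\<gamma> = (\<Sum>\<delta>\<in>B. if \<delta> = \<beta> then real (c \<beta>) *\<^sub>R \<beta> else 0)"
    unfolding c by (rule sum.cong) (auto simp: z)
  then have "\<gamma> = real (c \<beta>) *\<^sub>R \<beta>" using b finite_B by simp
  moreover from this have "real (c \<beta>) = 1 \<or> real (c \<beta>) = -1"
    using root_multiple[OF bD, of "real (c \<beta>)"] gD by simp
  then have "real (c \<beta>) = 1" using of_nat_0_le_iff[of "c \<beta>", where ?'a = real] by linarith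
  ultimately show False using ne by simp
qed

text \<open>
  The reflection in \<open>\<beta>\<close> permutes the positive roots other than \<open>\<beta>\<close> and negates their
  pairings with the coroot of \<open>\<beta>\<close>, so these pairings sum to 0 and only \<open>\<beta>\<close> itself contributes.
\<close>
lemma rho_simple:
  assumes b: "\<beta> \<in> B"
  shows "rho \<Delta> B \<bullet> coroot \<beta> = 1"
proof -
  have bP: "\<beta> \<in> Pos" using b simple_pos by auto
  then have nz: "\<beta> \<noteq> 0" using Pos_sub root_nz by blast
  let ?S = "\<Sum>\<gamma>\<in>Pos - {\<beta>}. \<gamma> \<bullet> coroot \<beta>"
  have neg: "refl \<beta> \<gamma> \<bullet> coroot \<beta> = - (\<gamma> \<bullet> coroot \<beta>)" for \<gamma>
    using nz by (simp add: refl_def inner_diff_left inner_coroot_self)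
  have mem: "refl \<beta> \<gamma> \<in> Pos - {\<beta>}" if "\<gamma> \<in> Pos - {\<beta>}" for \<gamma>
  proof -
    have "refl \<beta> \<gamma> \<in> Pos" using refl_simple_pos b that by auto
    moreover have "refl \<beta> \<gamma> \<noteq> \<beta>"
    proof
      assume "refl \<beta> \<gamma> = \<beta>"
      then have "\<gamma> = - \<beta>" using refl_refl[of \<beta> \<gamma>] refl_self[OF nz] by simp
      then show False using that not_pos_minus bP by auto
    qed
    ultimately show ?thesis by simp
  qed
  have "?S = (\<Sum>\<gamma>\<in>Pos - {\<beta>}. refl \<beta> \<gamma> \<bullet> coroot \<beta>)"
    by (rule sum.reindex_bij_witness[of _ "refl \<beta>" "refl \<beta>"]) (use mem in auto)
  also have "\<dots> = - ?S" by (simp add: neg sum_negf)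
  finally have "?S = 0" by simp
  moreover have "(\<Sum>\<gamma>\<in>Pos. \<gamma> \<bullet> coroot \<beta>) = \<beta> \<bullet> coroot \<beta> + ?S"
    using finite_Pos bP by (rule sum.remove)
  ultimately show ?thesis
    using nz by (simp add: rho_def inner_sum_left inner_coroot_self)
qed

lemma rho_coroot_height:
  assumes g: "\<gamma> = (\<Sum>\<beta>\<in>B. real (c \<beta>) *\<^sub>R \<beta>)" and gD: "\<gamma> \<in> \<Delta>"
  shows "rho \<Delta> B \<bullet> coroot \<gamma> = (\<Sum>\<beta>\<in>B. real (c \<beta>))"
proof -
  have sq: "\<beta> \<bullet> \<beta> = \<gamma> \<bullet> \<gamma>" if "\<beta> \<in> B" for \<beta>
    using that B_sub gD by (intro root_sq) auto
  have "coroot \<gamma> = (2 / (\<gamma> \<bullet> \<gamma>)) *\<^sub>R (\<Sum>\<beta>\<in>B. real (c \<beta>) *\<^sub>R \<beta>)"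
    by (simp only: coroot_def flip: g)
  also have "\<dots> = (\<Sum>\<beta>\<in>B. real (c \<beta>) *\<^sub>R coroot \<beta>)"
    unfolding scaleR_sum_right by (rule sum.cong) (auto simp: coroot_def sq)
  finally show ?thesis using rho_simple by (simp add: inner_sum_right)
qed

lemma rho_eq_1_simple:
  assumes g: "\<gamma> \<in> Pos" and r: "rho \<Delta> B \<bullet> coroot \<gamma> = 1"
  shows "\<gamma> \<in> B"
proof -
  obtain c where c: "\<gamma> = (\<Sum>\<beta>\<in>B. real (c \<beta>) *\<^sub>R \<beta>)" using pos_coeffs[OF g] .
  have "real (\<Sum>\<beta>\<in>B. c \<beta>) = 1" using rho_coroot_height[OF c] g Pos_sub r by auto
  then have s: "(\<Sum>\<beta>\<in>B. c \<beta>) = 1" by linarith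
  then obtain \<beta> where b: "\<beta> \<in> B" "c \<beta> = 1" "\<forall>\<delta>\<in>B. \<beta> \<noteq> \<delta> \<longrightarrow> c \<delta> = 0"
    using finite_B sum_eq_1_iff by meson
  have "\<gamma> = (\<Sum>\<delta>\<in>B. if \<delta> = \<beta> then \<beta> else 0)"
    unfolding c by (rule sum.cong) (use b in auto)
  then show ?thesis using b finite_B by simp
qed

text \<open>
  The value \<open>1/2\<close> is the one for which two opposite quantum edges, each changing the length by
  \<open>1 - 2 \<langle>\<rho>, \<gamma>\<^sup>\<or>\<rangle>\<close>, would cancel.
\<close>
lemma rho_pos_ne_half:
  assumes g: "\<gamma> \<in> Pos"
  shows "rho \<Delta> B \<bullet> coroot \<gamma> \<noteq> 1/2"
proof
  assume h: "rho \<Delta> B \<bullet> coroot \<gamma> = 1/2"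
  obtain c where c: "\<gamma> = (\<Sum>\<beta>\<in>B. real (c \<beta>) *\<^sub>R \<beta>)" using pos_coeffs[OF g] .
  have "real (\<Sum>\<beta>\<in>B. c \<beta>) = 1/2" using rho_coroot_height[OF c] g Pos_sub h by auto
  then have "real (2 * (\<Sum>\<beta>\<in>B. c \<beta>)) = real 1" by simp
  then show False unfolding of_nat_eq_iff by presburger
qed

lemma weyl_props:
  assumes "w \<in> weyl \<Delta>"
  shows "linear w \<and> bij w \<and> (\<forall>u v. w u \<bullet> w v = u \<bullet> v) \<and> (\<forall>\<gamma>\<in>\<Delta>. w \<gamma> \<in> \<Delta>) \<and>
    (\<forall>\<gamma>\<in>\<Delta>. inv w \<gamma> \<in> \<Delta>)"
  using assms
proof induction
  case weyl_id
  show ?case using linear_ident bij_id[unfolded id_def] by simp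
next
  case (weyl_refl \<alpha> w)
  have br: "bij (refl \<alpha>)" by (rule o_bij[of "refl \<alpha>"]) (simp_all add: refl_comp_refl)
  have ir: "inv (refl \<alpha>) = refl \<alpha>" by (rule inv_unique_comp) (simp_all add: refl_comp_refl)
  have inv: "inv (refl \<alpha> \<circ> w) = inv w \<circ> refl \<alpha>"
    using o_inv_distrib[of "refl \<alpha>" w] br weyl_refl ir by auto
  have lin: "linear (refl \<alpha> \<circ> w)" and bij: "bij (refl \<alpha> \<circ> w)"
    using weyl_refl linear_compose[OF _ linear_refl] bij_comp[OF _ br] by auto
  show ?case
    using weyl_refl inv[unfolded o_def] lin[unfolded o_def] bij[unfolded o_def]
    by (simp add: inner_refl_refl refl_root)
qed

lemma weyl_linear: "w \<in> weyl \<Delta> \<Longrightarrow> linear w"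
  and weyl_bij: "w \<in> weyl \<Delta> \<Longrightarrow> bij w"
  and weyl_inner: "w \<in> weyl \<Delta> \<Longrightarrow> w u \<bullet> w v = u \<bullet> v"
  and weyl_root: "w \<in> weyl \<Delta> \<Longrightarrow> \<gamma> \<in> \<Delta> \<Longrightarrow> w \<gamma> \<in> \<Delta>"
  and weyl_inv_root: "w \<in> weyl \<Delta> \<Longrightarrow> \<gamma> \<in> \<Delta> \<Longrightarrow> inv w \<gamma> \<in> \<Delta>"
  using weyl_props by auto

lemma weyl_inv_linear: "w \<in> weyl \<Delta> \<Longrightarrow> linear (inv w)"
  by (rule inj_linear_imp_inv_linear) (auto simp: weyl_linear weyl_bij bij_is_inj)

lemma weyl_inv_inner: "w \<in> weyl \<Delta> \<Longrightarrow> inv w u \<bullet> inv w v = u \<bullet> v"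
  using weyl_inner[of w "inv w u" "inv w v"] weyl_bij[of w]
  by (simp add: bij_is_surj surj_f_inv_f)

lemma weyl_inv_coroot: "w \<in> weyl \<Delta> \<Longrightarrow> inv w (coroot \<gamma>) = coroot (inv w \<gamma>)"
  using refl_isometry_image(2)[OF weyl_inv_linear weyl_inv_inner] by simp

lemma inv_refl_comp: "w \<in> weyl \<Delta> \<Longrightarrow> inv (refl \<alpha> \<circ> w) v = inv w (refl \<alpha> v)"
proof -
  assume w: "w \<in> weyl \<Delta>"
  have "inv (refl \<alpha> \<circ> w) = inv w \<circ> refl \<alpha>"
    by (rule inv_unique_comp) (use weyl_bij[OF w] in \<open>auto simp: fun_eq_iff bij_is_inj bij_is_surj surj_f_inv_f\<close>)
  then show ?thesis by simp
qed

lemma weyl_comp_refl: "w \<in> weyl \<Delta> \<Longrightarrow> w \<circ> refl \<gamma> = refl (w \<gamma>) \<circ> w"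
  using refl_isometry_image(1)[OF weyl_linear[of w] weyl_inner[of w]] by (simp add: fun_eq_iff)

lemma refl_comp_weyl: "w \<in> weyl \<Delta> \<Longrightarrow> refl \<alpha> \<circ> w = w \<circ> refl (inv w \<alpha>)"
  using weyl_comp_refl[of w "inv w \<alpha>"] weyl_bij by (simp add: bij_is_surj surj_f_inv_f)

lemma refl_comp_ne: "\<alpha> \<in> \<Delta> \<Longrightarrow> w \<in> weyl \<Delta> \<Longrightarrow> refl \<alpha> \<circ> w \<noteq> w"
proof
  assume a: "\<alpha> \<in> \<Delta>" and w: "w \<in> weyl \<Delta>" and e: "refl \<alpha> \<circ> w = w"
  have "refl \<alpha> \<alpha> = \<alpha>"
    using fun_cong[OF e, of "inv w \<alpha>"] weyl_bij[OF w] by (simp add: bij_is_surj surj_f_inv_f)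
  then have "- \<alpha> = \<alpha>" using refl_self[OF root_nz[OF a]] by simp
  then have "2 *\<^sub>R \<alpha> = 0" by (metis add.left_inverse scaleR_2)
  then show False using root_nz[OF a] by simp
qed

section \<open>Length and simple reflections\<close>

lemma word_weyl: "set bs \<subseteq> \<Delta> \<Longrightarrow> word bs \<in> weyl \<Delta>"
  by (induction bs) (auto intro: weyl_id_mem weyl_refl_mem)

lemma word_append: "word (as @ bs) = word as \<circ> word bs"
  by (induction as) (simp_all add: comp_assoc)

text \<open>
  Induction on the height. A positive root that is not simple pairs positively with some simple root,
  and reflecting in that root lowers the height; the reflections are conjugate.
\<close>
lemma pos_refl_word:
  "\<gamma> \<in> Pos \<Longrightarrow> \<exists>bs. set bs \<subseteq> B \<and> refl \<gamma> = word bs"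
proof (induction "nat \<lfloor>rho \<Delta> B \<bullet> coroot \<gamma>\<rfloor>" arbitrary: \<gamma> rule: less_induct)
  case less
  note g = less.prems
  show ?case
  proof (cases "\<gamma> \<in> B")
    case True
    then show ?thesis by (intro exI[of _ "[\<gamma>]"]) simp
  next
    case False
    have gD: "\<gamma> \<in> \<Delta>" using g Pos_sub by auto
    obtain c where c: "\<gamma> = (\<Sum>\<beta>\<in>B. real (c \<beta>) *\<^sub>R \<beta>)" using pos_coeffs[OF g] .
    have "0 < \<gamma> \<bullet> \<gamma>" using root_nz[OF gD] by simp
    also have "\<gamma> \<bullet> \<gamma> = (\<Sum>\<beta>\<in>B. real (c \<beta>) * (\<gamma> \<bullet> \<beta>))"
      by (subst (2) c) (simp add: inner_sum_right)
    finally obtain \<beta> where b: "\<beta> \<in> B" "0 < real (c \<beta>) * (\<gamma> \<bullet> \<beta>)"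
      by (meson not_less sum_nonpos)
    then have gb: "0 < \<gamma> \<bullet> \<beta>" by (simp add: zero_less_mult_iff)
    have bD: "\<beta> \<in> \<Delta>" using b B_sub by auto
    define n where "n = \<gamma> \<bullet> coroot \<beta>"
    have "0 < n" using gb root_nz[OF bD] by (simp add: n_def coroot_def)
    moreover have "n \<in> \<int>" unfolding n_def using root_int bD gD by auto
    ultimately have n1: "n \<ge> 1" by (auto elim!: Ints_cases)
    let ?d = "refl \<beta> \<gamma>"
    have dP: "?d \<in> Pos" using refl_simple_pos b g False by blast
    have sq: "\<beta> \<bullet> \<beta> = \<gamma> \<bullet> \<gamma>"
      using bD gD by (rule root_sq)
    have "coroot ?d = coroot \<gamma> - n *\<^sub>R coroot \<beta>"
      unfolding coroot_def[of ?d] inner_refl_refl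
      by (simp add: refl_def n_def coroot_def sq scaleR_diff_right)
    then have rd: "rho \<Delta> B \<bullet> coroot ?d = rho \<Delta> B \<bullet> coroot \<gamma> - n"
      using rho_simple[OF b(1)] by (simp add: inner_diff_right)
    have "rho \<Delta> B \<bullet> coroot ?d \<ge> 0"
    proof -
      obtain c where c: "?d = (\<Sum>\<beta>\<in>B. real (c \<beta>) *\<^sub>R \<beta>)" using pos_coeffs[OF dP] .
      have "rho \<Delta> B \<bullet> coroot ?d = (\<Sum>\<beta>\<in>B. real (c \<beta>))"
        using rho_coroot_height[OF c] dP Pos_sub by blast
      then show ?thesis by (simp add: sum_nonneg)
    qed
    then have "nat \<lfloor>rho \<Delta> B \<bullet> coroot ?d\<rfloor> < nat \<lfloor>rho \<Delta> B \<bullet> coroot \<gamma>\<rfloor>"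
      using rd n1 by linarith
    from less.hyps[OF this dP] obtain bs where bs: "set bs \<subseteq> B" "refl ?d = word bs" by blast
    have "refl \<gamma> = refl \<beta> \<circ> refl ?d \<circ> refl \<beta>"
      using refl_isometry_image(1)[OF linear_refl inner_refl_refl, of \<beta> \<gamma>, symmetric]
      by (simp add: fun_eq_iff)
    also have "\<dots> = word (\<beta> # bs @ [\<beta>])"
      using bs by (simp add: word_append comp_assoc)
    finally show ?thesis using bs b by (intro exI[of _ "\<beta> # bs @ [\<beta>]"]) simp
  qed
qed

lemma weyl_word: "w \<in> weyl \<Delta> \<Longrightarrow> \<exists>bs. set bs \<subseteq> B \<and> w = word bs"
proof (induction rule: weyl.induct)
  case weyl_id
  then show ?case by (intro exI[of _ "[]"]) simp
next
  case (weyl_refl \<alpha> w)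
  have "\<exists>as. set as \<subseteq> B \<and> refl \<alpha> = word as"
    using pos_refl_word[of \<alpha>] pos_refl_word[of "- \<alpha>"] pos_minus_iff[OF weyl_refl(1)] by auto
  then obtain as bs where "set as \<subseteq> B" "refl \<alpha> = word as" "set bs \<subseteq> B" "w = word bs"
    using weyl_refl by blast
  then show ?case by (intro exI[of _ "as @ bs"]) (simp only: word_append set_append, simp)
qed

lemma reduced_word:
  assumes "w \<in> weyl \<Delta>"
  obtains bs where "set bs \<subseteq> B" "w = word bs" "length bs = len w"
proof -
  have "\<exists>n bs. length bs = n \<and> set bs \<subseteq> B \<and> w = word bs" using weyl_word[OF assms] by auto
  from LeastI_ex[OF this] show ?thesis using that unfolding weyl_length_def foldr_word by auto
qed

lemma len_le: "set bs \<subseteq> B \<Longrightarrow> len (word bs) \<le> length bs"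
  unfolding weyl_length_def foldr_word by (rule Least_le) auto

text \<open>
  The exchange property. Reading the word from the right, \<open>\<beta>\<close> stays positive until some letter
  \<open>b\<close> makes it negative. At that moment it equals \<open>b\<close>, and commuting the reflection in \<open>\<beta>\<close> past
  the letters already read cancels \<open>b\<close>.
\<close>
lemma word_exchange:
  assumes "set bs \<subseteq> B" and "\<beta> \<in> B" and "word bs \<beta> \<notin> Pos"
  shows "\<exists>cs. set cs \<subseteq> B \<and> length bs = Suc (length cs) \<and> word bs \<circ> refl \<beta> = word cs"
  using assms(1,3)
proof (induction bs)
  case Nil
  then show ?case using simple_pos assms(2) by auto
next
  case (Cons b bs)
  let ?v = "word bs"
  have v: "?v \<in> weyl \<Delta>" using Cons.prems(1) B_sub by (intro word_weyl) auto
  show ?case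
  proof (cases "?v \<beta> \<in> Pos")
    case False
    then obtain cs where "set cs \<subseteq> B" "length bs = Suc (length cs)" "?v \<circ> refl \<beta> = word cs"
      using Cons.IH Cons.prems(1) by (meson set_subset_Cons subset_trans)
    then show ?thesis using Cons.prems(1)
      by (intro exI[of _ "b # cs"]) (simp add: fun_eq_iff)
  next
    case True
    have "?v \<beta> = b" using refl_simple_pos[of b "?v \<beta>"] True Cons.prems by auto
    then have "word (b # bs) \<circ> refl \<beta> = ?v"
      using weyl_comp_refl[OF v, of \<beta>] by (simp add: fun_eq_iff)
    then show ?thesis using Cons.prems(1) by (intro exI[of _ bs]) (simp add: fun_eq_iff)
  qed
qed

lemma weyl_comp_refl_mem: "w \<in> weyl \<Delta> \<Longrightarrow> \<gamma> \<in> \<Delta> \<Longrightarrow> w \<circ> refl \<gamma> \<in> weyl \<Delta>"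
  by (simp add: weyl_comp_refl weyl_root weyl_refl_mem)

lemma len_comp_simple_le: "w \<in> weyl \<Delta> \<Longrightarrow> \<beta> \<in> B \<Longrightarrow> len (w \<circ> refl \<beta>) \<le> Suc (len w)"
proof -
  assume w: "w \<in> weyl \<Delta>" and b: "\<beta> \<in> B"
  obtain bs where bs: "set bs \<subseteq> B" "w = word bs" "length bs = len w" using reduced_word[OF w] .
  have "w \<circ> refl \<beta> = word (bs @ [\<beta>])" using bs(2) by (simp add: word_append)
  then show ?thesis using len_le[of "bs @ [\<beta>]"] bs b by simp
qed

lemma len_descent:
  assumes w: "w \<in> weyl \<Delta>" and b: "\<beta> \<in> B" and n: "w \<beta> \<notin> Pos"
  shows "len w = Suc (len (w \<circ> refl \<beta>))"
proof -
  obtain bs where bs: "set bs \<subseteq> B" "w = word bs" "length bs = len w" using reduced_word[OF w] .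
  obtain cs where cs: "set cs \<subseteq> B" "length bs = Suc (length cs)" "w \<circ> refl \<beta> = word cs"
    using word_exchange[OF bs(1) b] n bs(2) by auto
  have "len (w \<circ> refl \<beta>) \<le> length cs" using len_le[OF cs(1)] cs(3) by simp
  moreover have "len (w \<circ> refl \<beta> \<circ> refl \<beta>) \<le> Suc (len (w \<circ> refl \<beta>))"
    using len_comp_simple_le weyl_comp_refl_mem w b B_sub by blast
  ultimately show ?thesis using bs cs by (simp add: comp_assoc refl_comp_refl)
qed

lemma len_ascent:
  assumes w: "w \<in> weyl \<Delta>" and b: "\<beta> \<in> B" and n: "w \<beta> \<in> Pos"
  shows "len (w \<circ> refl \<beta>) = Suc (len w)"
proof -
  have bD: "\<beta> \<in> \<Delta>" using b B_sub by auto
  have "(w \<circ> refl \<beta>) \<beta> = - w \<beta>"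
    using refl_self[OF root_nz[OF bD]] linear_neg[OF weyl_linear[OF w]] by simp
  then have "(w \<circ> refl \<beta>) \<beta> \<notin> Pos" using n not_pos_minus by auto
  from len_descent[of "w \<circ> refl \<beta>", OF weyl_comp_refl_mem[OF w bD] b this] show ?thesis
    by (simp add: comp_assoc refl_comp_refl)
qed

lemma bruhat_less_len: "bruhat_less \<Delta> B x y \<Longrightarrow> len x < len y"
  unfolding bruhat_less_def by (induction rule: tranclp_induct) auto

text \<open>
  Left multiplication by \<open>s\<^sub>\<alpha>\<close> is right multiplication by a simple reflection \<open>s\<^sub>\<gamma>\<close> here, so
  the two elements are Bruhat neighbours, and the smaller one is determined by the sign of
  \<open>x \<gamma>\<close>, where \<open>x \<gamma>\<close> is \<open>\<alpha>\<close> or \<open>-\<alpha>\<close>. The downward edge is quantum because \<open>\<langle>\<rho>, \<gamma>\<^sup>\<or>\<rangle> = 1\<close>.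
\<close>
lemma simple_reflection_edges:
  assumes x: "x \<in> weyl \<Delta>" and a: "\<alpha> \<in> \<Delta>" and b: "inv x \<alpha> \<in> B \<or> - inv x \<alpha> \<in> B"
  shows "bruhat_less \<Delta> B (refl \<alpha> \<circ> x) x \<longleftrightarrow> (inv x \<alpha> \<in> B) \<noteq> (\<alpha> \<in> Pos)"
    and "bruhat_less \<Delta> B x (refl \<alpha> \<circ> x) \<longleftrightarrow> (inv x \<alpha> \<in> B) = (\<alpha> \<in> Pos)"
    and "\<exists>\<gamma>. qbg_edge \<Delta> B x \<gamma> (refl \<alpha> \<circ> x)"
    and "\<exists>\<gamma>. qbg_edge \<Delta> B (refl \<alpha> \<circ> x) \<gamma> x"
proof -
  define \<gamma> where "\<gamma> = (if inv x \<alpha> \<in> B then inv x \<alpha> else - inv x \<alpha>)"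
  have g: "\<gamma> \<in> B" using b by (auto simp: \<gamma>_def)
  then have gP: "\<gamma> \<in> Pos" and gD: "\<gamma> \<in> \<Delta>" using simple_pos Pos_sub by auto
  let ?s = "refl \<alpha> \<circ> x"
  have s: "?s = x \<circ> refl \<gamma>" using refl_comp_weyl[OF x] by (simp add: \<gamma>_def)
  then have x': "x = ?s \<circ> refl \<gamma>" by (simp add: comp_assoc refl_comp_refl)
  have sW: "?s \<in> weyl \<Delta>" using weyl_refl_mem x a by blast
  have xi: "x (inv x \<alpha>) = \<alpha>" using weyl_bij[OF x] by (simp add: bij_is_surj surj_f_inv_f)
  have xg: "x \<gamma> \<in> Pos \<longleftrightarrow> ((inv x \<alpha> \<in> B) = (\<alpha> \<in> Pos))"
    using xi linear_neg[OF weyl_linear[OF x]] pos_minus_iff[OF a] by (simp add: \<gamma>_def)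
  have up: "bruhat_less \<Delta> B u v" if "u \<in> weyl \<Delta>" "v = u \<circ> refl \<gamma>" "len u < len v" for u v
    unfolding bruhat_less_def using that gP by blast
  have L: "if x \<gamma> \<in> Pos then len ?s = Suc (len x) else len x = Suc (len ?s)"
    using len_ascent[OF x g] len_descent[OF x g] unfolding s by auto
  show "bruhat_less \<Delta> B ?s x \<longleftrightarrow> (inv x \<alpha> \<in> B) \<noteq> (\<alpha> \<in> Pos)"
    using L up[OF sW x'] bruhat_less_len[of ?s x] xg by (auto split: if_splits)
  show "bruhat_less \<Delta> B x ?s \<longleftrightarrow> (inv x \<alpha> \<in> B) = (\<alpha> \<in> Pos)"
    using L up[OF x s] bruhat_less_len[of x ?s] xg by (auto split: if_splits)
  show "\<exists>\<gamma>. qbg_edge \<Delta> B x \<gamma> ?s" "\<exists>\<gamma>. qbg_edge \<Delta> B ?s \<gamma> x"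
    using L x sW gP s x' rho_simple[OF g] unfolding qbg_edge_def
    by (auto intro!: exI[of _ \<gamma>] split: if_splits)
qed

lemma refl_eq_imp_pm:
  assumes "\<gamma> \<in> \<Delta>" "\<delta> \<in> \<Delta>" "refl \<gamma> = refl \<delta>"
  shows "\<gamma> = \<delta> \<or> \<gamma> = - \<delta>"
proof -
  have "- \<gamma> = \<gamma> - (\<gamma> \<bullet> coroot \<delta>) *\<^sub>R \<delta>"
    using refl_self[OF root_nz[OF assms(1)]] assms(3) by (simp add: refl_def)
  then have d: "2 *\<^sub>R \<gamma> = (\<gamma> \<bullet> coroot \<delta>) *\<^sub>R \<delta>" by (simp add: algebra_simps scaleR_2)
  define c where "c = (\<gamma> \<bullet> coroot \<delta>) / 2"
  have c: "\<gamma> = c *\<^sub>R \<delta>"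
    using arg_cong[OF d, of "scaleR (1/2)"] by (simp add: c_def)
  then have "c = 1 \<or> c = -1" using root_multiple[OF assms(2), of c] assms(1) by simp
  then show ?thesis using c by auto
qed

text \<open>
  The length changes along the two edges cancel. Two Bruhat edges or two quantum edges cannot
  do this, and a Bruhat edge together with a quantum edge forces \<open>\<langle>\<rho>, \<gamma>\<^sup>\<or>\<rangle> = 1\<close>.
\<close>
lemma two_way_edge_simple:
  assumes x: "x \<in> weyl \<Delta>" and a: "\<alpha> \<in> \<Delta>"
    and "qbg_edge \<Delta> B x \<gamma> (refl \<alpha> \<circ> x)" and "qbg_edge \<Delta> B (refl \<alpha> \<circ> x) \<delta> x"
  shows "inv x \<alpha> \<in> B \<or> - inv x \<alpha> \<in> B"
proof -
  let ?s = "refl \<alpha> \<circ> x"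
  have inj: "inj x" using weyl_bij[OF x] bij_is_inj by auto
  have gP: "\<gamma> \<in> Pos" and dP: "\<delta> \<in> Pos" and sg: "?s = x \<circ> refl \<gamma>" and sd: "x = ?s \<circ> refl \<delta>"
    using assms(3,4) by (auto simp: qbg_edge_def)
  have "x \<circ> refl \<gamma> = x \<circ> refl (inv x \<alpha>)" using sg refl_comp_weyl[OF x] by simp
  then have r: "refl \<gamma> = refl (inv x \<alpha>)" using inj by (simp add: fun_eq_iff inj_def)
  have "?s = x \<circ> refl \<delta>" using arg_cong[OF sd, of "\<lambda>f. f \<circ> refl \<delta>"]
    by (simp add: comp_assoc refl_comp_refl)
  then have "refl \<gamma> = refl \<delta>" using sg inj by (simp add: fun_eq_iff inj_def)
  then have gd: "\<gamma> = \<delta>" using refl_eq_imp_pm[of \<gamma> \<delta>] gP dP Pos_sub not_pos_minus by blast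
  have "rho \<Delta> B \<bullet> coroot \<gamma> = 1"
    using assms(3,4) rho_pos_ne_half[OF gP] unfolding qbg_edge_def gd by auto
  then have "\<gamma> \<in> B" using rho_eq_1_simple gP by blast
  moreover have "\<gamma> = inv x \<alpha> \<or> \<gamma> = - inv x \<alpha>"
    using refl_eq_imp_pm r gP Pos_sub weyl_inv_root[OF x a] by blast
  ultimately show ?thesis by auto
qed

end

section \<open>Decorated walks as lists of choices\<close>

text \<open>
  What has to be remembered while reading a decorated walk from left to right: the position \<open>w\<^sub>t\<close>,
  the map \<open>r\<^sub>t\<close> composed of affine reflections, the quantum weight and its coroot version, the
  sign, and those terms of the degree that are sums over steps. The remaining term of the
  degree depends on the final state only.
\<close>
record 'a walk_state =
  position :: "'a \<Rightarrow> 'a"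
  aff_map :: "'a \<Rightarrow> 'a"
  qsum :: 'a
  cosum :: 'a
  parity :: int
  partial_deg :: real

text \<open>
  One step of a walk: the next position and the decoration, with the decoration 0 at steps
  that carry none.
\<close>
type_synonym 'a choice = "('a \<Rightarrow> 'a) \<times> nat"

definition negate :: "'a walk_state \<Rightarrow> 'a walk_state" where
  "negate s = s\<lparr>parity := - parity s\<rparr>"

lemma negate_negate [simp]: "negate (negate s) = s"
  by (simp add: negate_def)

context based_root_system
begin

definition choices :: "('a \<Rightarrow> 'a) \<Rightarrow> 'a \<Rightarrow> 'a choice set" where
  "choices x \<gamma> = {(y, c).
     y = x \<and> c \<in> (if - inv x \<gamma> \<in> B then {0, 1} else {0}) \<or>
     y = refl \<gamma> \<circ> x \<and> c = 0 \<and> (\<exists>\<alpha>. qbg_edge \<Delta> B x \<alpha> y)}"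

primrec walks :: "('a \<Rightarrow> 'a) \<Rightarrow> ('a \<times> int) list \<Rightarrow> 'a choice list set" where
  "walks x [] = {[]}"
| "walks x (g # gs) = {p # ps | p ps. p \<in> choices x (fst g) \<and> ps \<in> walks (fst p) gs}"

definition advance ::
    "'a \<Rightarrow> 'a walk_state \<Rightarrow> ('a \<times> int) \<times> 'a choice \<Rightarrow> 'a walk_state" where
  "advance \<mu> s = (\<lambda>((\<gamma>, l), (y, c)).
     let x = position s;
       down = bruhat_less \<Delta> B y x;
       dec = (y = x \<and> - inv y \<gamma> \<in> B);
       R = (if y = refl \<gamma> \<circ> x then aff_map s \<circ> aff_refl \<gamma> l else aff_map s);
       q = (if down then root_abs \<Delta> B (inv y \<gamma>) else 0) -
         (if dec then real c *\<^sub>R inv y \<gamma> else 0);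
       qc = cosum s + ((if down then coroot (root_abs \<Delta> B (inv y \<gamma>)) else 0) -
         (if dec then real c *\<^sub>R inv y (coroot \<gamma>) else 0));
       L = \<mu> \<bullet> coroot \<gamma> - of_int l
     in \<lparr>position = y, aff_map = R, qsum = qsum s + q, cosum = qc,
         parity = parity s * (if y = refl \<gamma> \<circ> x \<and> inv x \<gamma> \<in> Pos then -1 else 1) *
           (if dec then (-1) ^ c else 1),
         partial_deg = partial_deg s + ((R \<mu> - aff_map s \<mu>) \<bullet> qc -
           (if down then root_sgn \<Delta> B \<gamma> * L else 0) - (if dec then real c * L else 0))\<rparr>)"

definition run ::
    "'a \<Rightarrow> 'a walk_state \<Rightarrow> ('a \<times> int) list \<Rightarrow> 'a choice list \<Rightarrow> 'a walk_state" where
  "run \<mu> s gs ps = foldl (advance \<mu>) s (zip gs ps)"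

definition start :: "('a \<Rightarrow> 'a) \<Rightarrow> 'a walk_state" where
  "start w = \<lparr>position = w, aff_map = inv w, qsum = 0, cosum = 0, parity = 1, partial_deg = 0\<rparr>"

text \<open>
  The linear part of the affine map is the inverse of the position. This is what makes the weight
  steps of the two crossings by \<open>\<alpha>\<close> and \<open>-\<alpha>\<close> multiples of \<open>x\<^sup>-\<^sup>1 \<alpha>\<close>.
\<close>
definition coherent :: "'a walk_state \<Rightarrow> bool" where
  "coherent s \<longleftrightarrow> position s \<in> weyl \<Delta> \<and>
     (\<forall>\<nu> \<delta>. aff_map s (\<nu> + \<delta>) = aff_map s \<nu> + inv (position s) \<delta>)"

lemma bruhat_irrefl: "\<not> bruhat_less \<Delta> B x x"
  using bruhat_less_len by blast

lemma simple_not_both: "\<beta> \<in> B \<Longrightarrow> - \<beta> \<notin> B"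
  using simple_pos not_pos_minus by blast

lemma advance_stay:
  assumes "position s = x" and x: "x \<in> weyl \<Delta>" and g: "\<gamma> \<in> \<Delta>"
  shows "advance \<mu> s ((\<gamma>, l), (x, c)) =
    (if - inv x \<gamma> \<in> B
     then s\<lparr>qsum := qsum s - real c *\<^sub>R inv x \<gamma>,
       cosum := cosum s - real c *\<^sub>R coroot (inv x \<gamma>),
       parity := parity s * (-1) ^ c,
       partial_deg := partial_deg s - real c * (\<mu> \<bullet> coroot \<gamma> - of_int l)\<rparr>
     else s)"
  using assms(1) refl_comp_ne[OF g x]
  by (simp add: advance_def Let_def bruhat_irrefl weyl_inv_coroot[OF x])

lemma advance_cross:
  assumes "position s = x" and x: "x \<in> weyl \<Delta>" and g: "\<gamma> \<in> \<Delta>"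
  defines "y \<equiv> refl \<gamma> \<circ> x" and "\<beta> \<equiv> inv x \<gamma>"
  shows "advance \<mu> s ((\<gamma>, l), (y, c)) =
    \<lparr>position = y, aff_map = aff_map s \<circ> aff_refl \<gamma> l,
     qsum = qsum s + (if bruhat_less \<Delta> B y x then root_abs \<Delta> B \<beta> else 0),
     cosum = cosum s + (if bruhat_less \<Delta> B y x then coroot (root_abs \<Delta> B \<beta>) else 0),
     parity = parity s * (if \<beta> \<in> Pos then -1 else 1),
     partial_deg = partial_deg s +
       ((aff_map s (aff_refl \<gamma> l \<mu>) - aff_map s \<mu>) \<bullet>
          (cosum s + (if bruhat_less \<Delta> B y x then coroot (root_abs \<Delta> B \<beta>) else 0)) -
        (if bruhat_less \<Delta> B y x then root_sgn \<Delta> B \<gamma> * (\<mu> \<bullet> coroot \<gamma> - of_int l) else 0))\<rparr>"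
proof -
  have ne: "y \<noteq> x" using refl_comp_ne[OF g x] by (simp add: y_def)
  have "inv y \<gamma> = - \<beta>"
    unfolding y_def \<beta>_def inv_refl_comp[OF x] refl_self[OF root_nz[OF g]]
    by (rule linear_neg[OF weyl_inv_linear[OF x]])
  then have abs: "root_abs \<Delta> B (inv y \<gamma>) = root_abs \<Delta> B \<beta>"
    using root_abs_minus[OF weyl_inv_root[OF x g]] by (simp add: \<beta>_def)
  show ?thesis
    using assms(1) ne abs unfolding y_def[symmetric] \<beta>_def[symmetric]
    by (simp add: advance_def Let_def y_def[symmetric] \<beta>_def)
qed

lemma choices_weyl: "x \<in> weyl \<Delta> \<Longrightarrow> \<gamma> \<in> \<Delta> \<Longrightarrow> p \<in> choices x \<gamma> \<Longrightarrow> fst p \<in> weyl \<Delta>"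
  using weyl_refl_mem[of \<gamma> \<Delta> x] by (auto simp: choices_def)

lemma advance_position: "position (advance \<mu> s (g, p)) = fst p"
  by (simp add: advance_def Let_def split: prod.splits)

lemma coherent_advance:
  assumes s: "coherent s" and g: "\<gamma> \<in> \<Delta>" and p: "p \<in> choices (position s) \<gamma>"
  shows "coherent (advance \<mu> s ((\<gamma>, l), p))"
proof -
  define x where "x = position s"
  have x: "x \<in> weyl \<Delta>" using s by (simp add: coherent_def x_def)
  obtain y c where pc: "p = (y, c)" by fastforce
  consider "y = x" | "y = refl \<gamma> \<circ> x" using p pc by (auto simp: choices_def x_def)
  then show ?thesis
  proof cases
    case 1
    then show ?thesis using s pc advance_stay[OF x_def[symmetric] x g]
      by (simp add: coherent_def)
  next
    case 2
    have "coherent (advance \<mu> s ((\<gamma>, l), (refl \<gamma> \<circ> x, c)))"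
      unfolding advance_cross[OF x_def[symmetric] x g] coherent_def
      using s weyl_refl_mem[OF g x] inv_refl_comp[OF x]
      by (simp add: aff_refl_add coherent_def x_def)
    then show ?thesis using pc 2 by simp
  qed
qed

lemma aff_map_cross:
  assumes "coherent s" and "position s = x"
  shows "aff_map s (aff_refl \<alpha> k \<mu>) - aff_map s \<mu> = - ((\<mu> \<bullet> coroot \<alpha> - of_int k) *\<^sub>R inv x \<alpha>)"
proof -
  have x: "x \<in> weyl \<Delta>" using assms by (simp add: coherent_def)
  have "aff_refl \<alpha> k \<mu> = \<mu> + (- (\<mu> \<bullet> coroot \<alpha> - of_int k)) *\<^sub>R \<alpha>"
    by (simp add: aff_refl_def refl_def algebra_simps)
  then have "aff_map s (aff_refl \<alpha> k \<mu>) = aff_map s \<mu> + inv x ((- (\<mu> \<bullet> coroot \<alpha> - of_int k)) *\<^sub>R \<alpha>)"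
    using assms by (simp add: coherent_def)
  then show ?thesis using linear_scale[OF weyl_inv_linear[OF x]]
    by simp (simp add: algebra_simps)
qed

text \<open>
  The sign-reversing involution on the two steps \<open>\<alpha>, -\<alpha>\<close> taken from position \<open>x\<close>. It is
  meaningful only for pairs other than \<open>idle x\<close>. A walk that stays at \<open>x\<close> can be decorated
  at the first step only if \<open>-x\<^sup>-\<^sup>1 \<alpha>\<close> is simple, and at the second only if \<open>x\<^sup>-\<^sup>1 \<alpha>\<close> is.
\<close>
definition swap :: "('a \<Rightarrow> 'a) \<Rightarrow> 'a \<Rightarrow> 'a choice \<times> 'a choice \<Rightarrow> 'a choice \<times> 'a choice" where
  "swap x \<alpha> = (\<lambda>((y1, c1), (y2, c2)).
     let y = refl \<alpha> \<circ> x
     in if y2 = x then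
          (if y1 = x then ((y, 0), (x, 0))
           else if - inv x \<alpha> \<in> B then ((x, 1), (x, 0)) else ((x, 0), (x, 1)))
        else if y1 = x then ((y, 0), (y, c1)) else ((x, c2), (y, 0)))"

abbreviation "idle x \<equiv> ((x, 0), (x, 0))"

definition pairs :: "('a \<Rightarrow> 'a) \<Rightarrow> 'a \<Rightarrow> ('a choice \<times> 'a choice) set" where
  "pairs x \<alpha> = {(p1, p2). p1 \<in> choices x \<alpha> \<and> p2 \<in> choices (fst p1) (- \<alpha>)}"

definition advance2 ::
    "'a \<Rightarrow> 'a \<Rightarrow> int \<Rightarrow> 'a walk_state \<Rightarrow> 'a choice \<times> 'a choice \<Rightarrow> 'a walk_state" where
  "advance2 \<mu> \<alpha> k s = (\<lambda>(p1, p2). advance \<mu> (advance \<mu> s ((\<alpha>, k), p1)) ((- \<alpha>, - k), p2))"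

context
  fixes x :: "'a \<Rightarrow> 'a" and \<alpha> :: 'a
  assumes x: "x \<in> weyl \<Delta>" and a: "\<alpha> \<in> \<Delta>"
begin

lemma refl_comp_back: "refl \<alpha> \<circ> (refl \<alpha> \<circ> x) = x" "refl (- \<alpha>) \<circ> (refl \<alpha> \<circ> x) = x"
  by (simp_all add: refl_comp_refl_comp)

lemma inv_minus_root: "inv x (- \<alpha>) = - inv x \<alpha>"
  by (rule linear_neg[OF weyl_inv_linear[OF x]])

lemma inv_cross_root: "inv (refl \<alpha> \<circ> x) \<alpha> = - inv x \<alpha>" "inv (refl \<alpha> \<circ> x) (- \<alpha>) = inv x \<alpha>"
  unfolding inv_refl_comp[OF x] using refl_self[OF root_nz[OF a]] inv_minus_root
    linear_neg[OF linear_refl[of \<alpha>]] by simp_all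

text \<open>
  The list of all behaviours during the two steps. A detour through \<open>s\<^sub>\<alpha> x\<close> is
  possible exactly when a decoration is possible at \<open>x\<close>, which is the equivalence \<open>e\<close> in the proof.
\<close>
lemma pairs_cases:
  "pairs x \<alpha> =
     {idle x} \<union>
     (if inv x \<alpha> \<in> B then {((x, 0), (x, 1)), ((refl \<alpha> \<circ> x, 0), (x, 0))} else {}) \<union>
     (if - inv x \<alpha> \<in> B then {((x, 1), (x, 0)), ((refl \<alpha> \<circ> x, 0), (x, 0))} else {}) \<union>
     {((y1, c1), (y2, c2)). (\<exists>\<gamma>. qbg_edge \<Delta> B x \<gamma> (refl \<alpha> \<circ> x)) \<and>
        y2 = refl \<alpha> \<circ> x \<and> (y1 = x \<and> c2 = 0 \<or> y1 = refl \<alpha> \<circ> x \<and> c1 = 0) \<and>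
        c1 + c2 \<in> (if - inv x \<alpha> \<in> B then {0, 1} else {0})}"
  (is "_ = ?R")
proof -
  let ?y = "refl \<alpha> \<circ> x"
  have ne: "?y \<noteq> x" "x \<noteq> ?y" using refl_comp_ne[OF a x] by auto
  define E where "E \<longleftrightarrow> (\<exists>\<gamma>. qbg_edge \<Delta> B x \<gamma> ?y)"
  define E' where "E' \<longleftrightarrow> (\<exists>\<gamma>. qbg_edge \<Delta> B ?y \<gamma> x)"
  have 1: "choices x \<alpha> = {x} \<times> (if - inv x \<alpha> \<in> B then {0, 1} else {0}) \<union>
      (if E then {(?y, 0)} else {})"
    by (auto simp: choices_def E_def)
  have 2: "choices x (- \<alpha>) = {x} \<times> (if inv x \<alpha> \<in> B then {0, 1} else {0}) \<union>
      (if E then {(?y, 0)} else {})"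
    by (auto simp: choices_def inv_minus_root E_def)
  have 3: "choices ?y (- \<alpha>) = {?y} \<times> (if - inv x \<alpha> \<in> B then {0, 1} else {0}) \<union>
      (if E' then {(x, 0)} else {})"
    unfolding choices_def inv_cross_root refl_comp_back E'_def by auto
  have e: "E \<and> E' \<longleftrightarrow> inv x \<alpha> \<in> B \<or> - inv x \<alpha> \<in> B"
    using simple_reflection_edges(3,4)[OF x a] two_way_edge_simple[OF x a] unfolding E_def E'_def by blast
  have P: "pairs x \<alpha> = (SIGMA p1 : choices x \<alpha>. choices (fst p1) (- \<alpha>))"
    by (auto simp: pairs_def)
  show ?thesis
    unfolding E_def[symmetric] P 1
    using simple_not_both[of "inv x \<alpha>"] e ne
    by (cases "inv x \<alpha> \<in> B"; cases "- inv x \<alpha> \<in> B"; cases E; cases E')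
      (simp_all add: 2 3 Sigma_Un_distrib1, auto simp: 2 3)
qed

lemma swap_pairs:
  assumes "p \<in> pairs x \<alpha> - {idle x}"
  shows "swap x \<alpha> p \<in> pairs x \<alpha> - {idle x}" and "swap x \<alpha> (swap x \<alpha> p) = p"
    and "fst (snd (swap x \<alpha> p)) = fst (snd p)"
  using assms refl_comp_ne[OF a x] refl_comp_ne[OF a x, symmetric] simple_not_both[of "inv x \<alpha>"]
  unfolding pairs_cases swap_def
  by (auto simp: Let_def split: if_splits)

text \<open>
  Put \<open>\<beta> = x\<^sup>-\<^sup>1 \<alpha>\<close> and \<open>L = \<langle>\<mu>, \<alpha>\<^sup>\<or>\<rangle> - k\<close>. Both orders have the weight step \<open>-L \<beta>\<close> and, if the
  crossing goes down, the quantum contribution \<open>|\<beta>| = |-\<beta>|\<close>; a decoration contributes \<open>-c \<beta>\<close> in both.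
  Decorating after the crossing adds \<open>c L\<close> to the degree, since the colevel of the
  second step is \<open>-L\<close>. Decorating before it adds \<open>-c L\<close>, but also shifts the quantum weight by
  \<open>-c \<beta>\<^sup>\<or>\<close> before the weight step \<open>-L \<beta>\<close>, which adds \<open>2 c L\<close>.
\<close>
lemma advance2_cross_stay:
  assumes s: "coherent s" and p: "position s = x"
  defines "y \<equiv> refl \<alpha> \<circ> x"
  shows "advance2 \<mu> \<alpha> k s ((y, 0), (y, c)) = negate (advance2 \<mu> \<alpha> k s ((x, c), (y, 0)))"
proof -
  have y: "y \<in> weyl \<Delta>" using weyl_refl_mem[OF a x] by (simp add: y_def)
  have b: "inv x \<alpha> \<in> \<Delta>" by (rule weyl_inv_root[OF x a])
  have m: "- \<alpha> \<in> \<Delta>" using minus_root[OF a] .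
  have y': "y = refl (- \<alpha>) \<circ> x" by (simp add: y_def)
  note bb = inner_coroot_self[OF root_nz[OF b]]
  define L where "L = \<mu> \<bullet> coroot \<alpha> - of_int k"
  have L: "\<mu> \<bullet> coroot \<alpha> = L + of_int k" by (simp add: L_def)
  have aff: "aff_map s (aff_refl \<alpha> k \<mu>) = aff_map s \<mu> - L *\<^sub>R inv x \<alpha>"
    using aff_map_cross[OF s p, of \<alpha> k \<mu>] by (simp add: L_def algebra_simps)
  note cross1 = advance_cross[of s x \<alpha> \<mu> k 0, OF p x a, folded y_def]
  have "position (advance \<mu> s ((\<alpha>, k), (x, c))) = x" by (simp add: advance_position)
  note cross2 = advance_cross[OF this x m, of \<mu> "- k" 0, folded y']
  show ?thesis
  proof (cases "- inv x \<alpha> \<in> B")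
    case True
    then have pos: "inv x \<alpha> \<notin> Pos" "- inv x \<alpha> \<in> Pos"
      using simple_pos not_pos_minus[of "- inv x \<alpha>"] by auto
    show ?thesis
      unfolding advance2_def prod.case cross1 cross2
      using True pos inv_cross_root[folded y_def]
      by (simp add: advance_stay[OF p x a] advance_stay[OF _ y m] negate_def y_def[symmetric]
          inv_minus_root root_abs_minus[OF b] root_sgn_minus[OF a] aff_refl_minus
          L aff inner_add_right inner_diff_right inner_diff_left bb algebra_simps)
  next
    case False
    then show ?thesis
      unfolding advance2_def prod.case cross1 cross2
      using inv_cross_root[folded y_def] pos_minus_iff[OF b]
      by (simp add: advance_stay[OF p x a] advance_stay[OF _ y m] negate_def y_def[symmetric]
          inv_minus_root root_abs_minus[OF b] root_sgn_minus[OF a] aff_refl_minus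
          L aff inner_add_right inner_diff_right inner_diff_left bb algebra_simps)
  qed
qed

text \<open>
  With the same \<open>\<beta>\<close> and \<open>L\<close>, the detour has the weight steps \<open>-L \<beta>\<close> and \<open>L \<beta>\<close> and goes down
  exactly once, which adds \<open>|\<beta>|\<close> to the quantum weight; the decoration 1 adds \<open>|\<beta>|\<close> as well. The detour
  has sign 1, as both of its crossings count with \<open>\<beta>\<close>. Its term over the downward steps is
  \<open>-sgn(\<alpha>) L\<close> at either step, because the sign of the root and the colevel change together. If the
  second step is the downward one, the weight steps contribute \<open>L \<langle>\<beta>, |\<beta>|\<^sup>\<or>\<rangle>\<close>, which is \<open>2 L\<close> or
  \<open>-2 L\<close>; otherwise they contribute 0. In all four cases of the signs of \<open>\<alpha>\<close> and \<open>\<beta>\<close> the sum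
  is \<open>L\<close> if \<open>\<beta>\<close> is simple and \<open>-L\<close> if \<open>-\<beta>\<close> is, as for the decorated walk.
\<close>
lemma advance2_cross_cross:
  assumes s: "coherent s" and p: "position s = x"
    and simple: "inv x \<alpha> \<in> B \<or> - inv x \<alpha> \<in> B"
  defines "y \<equiv> refl \<alpha> \<circ> x"
  shows "advance2 \<mu> \<alpha> k s ((y, 0), (x, 0)) = negate (advance2 \<mu> \<alpha> k s
    (if - inv x \<alpha> \<in> B then ((x, 1), (x, 0)) else ((x, 0), (x, 1))))"
proof -
  have y: "y \<in> weyl \<Delta>" using weyl_refl_mem[OF a x] by (simp add: y_def)
  have b: "inv x \<alpha> \<in> \<Delta>" by (rule weyl_inv_root[OF x a])
  have m: "- \<alpha> \<in> \<Delta>" using minus_root[OF a] .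
  have x': "x = refl (- \<alpha>) \<circ> y" using refl_comp_back by (simp add: y_def)
  note bb = inner_coroot_self[OF root_nz[OF b]]
  define L where "L = \<mu> \<bullet> coroot \<alpha> - of_int k"
  have L: "\<mu> \<bullet> coroot \<alpha> = L + of_int k" by (simp add: L_def)
  have aff: "aff_map s (aff_refl \<alpha> k \<mu>) = aff_map s \<mu> - L *\<^sub>R inv x \<alpha>"
    using aff_map_cross[OF s p, of \<alpha> k \<mu>] by (simp add: L_def algebra_simps)
  note cross1 = advance_cross[of s x \<alpha> \<mu> k 0, OF p x a, folded y_def]
  have "position (advance \<mu> s ((\<alpha>, k), (y, 0))) = y" by (simp add: advance_position)
  note cross2 = advance_cross[OF this y m, of \<mu> "- k" 0, folded x']
  have aa: "aff_map s \<circ> aff_refl \<alpha> k \<circ> aff_refl \<alpha> k = aff_map s"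
    using root_nz[OF a] by (simp add: fun_eq_iff)
  note down = simple_reflection_edges(1,2)[OF x a simple, folded y_def]
  note iy = inv_cross_root(2)[folded y_def]
  show ?thesis
  proof (cases "- inv x \<alpha> \<in> B")
    case True
    then have pos: "inv x \<alpha> \<notin> Pos" "- inv x \<alpha> \<in> Pos" and nb: "inv x \<alpha> \<notin> B"
      using simple_pos not_pos_minus[of "- inv x \<alpha>"] simple_not_both[of "- inv x \<alpha>"] by auto
    show ?thesis
      unfolding advance2_def prod.case unfolding cross2 unfolding cross1
      using True pos nb p down root_nz[OF a]
      by (simp add: advance_stay[OF p x a] advance_stay[OF _ x m] negate_def iy
          inv_minus_root root_abs_def root_sgn_def pos_minus_iff[OF a] aff_refl_minus
          L aff aa inner_add_right inner_diff_right inner_diff_left bb algebra_simps)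
  next
    case False
    then have bB: "inv x \<alpha> \<in> B" and pos: "inv x \<alpha> \<in> Pos" "- inv x \<alpha> \<notin> Pos"
      using simple simple_pos not_pos_minus[of "inv x \<alpha>"] by auto
    show ?thesis
      unfolding advance2_def prod.case unfolding cross2 unfolding cross1
      using False pos bB p down root_nz[OF a]
      by (simp add: advance_stay[OF p x a] advance_stay[OF _ x m] negate_def iy
          inv_minus_root root_abs_def root_sgn_def pos_minus_iff[OF a] aff_refl_minus
          L aff aa inner_add_right inner_diff_right inner_diff_left bb algebra_simps)
  qed
qed

lemma advance2_idle: "position s = x \<Longrightarrow> advance2 \<mu> \<alpha> k s (idle x) = s"
  using advance_stay[OF _ x a, of s \<mu> k 0] advance_stay[OF _ x minus_root[OF a], of s \<mu> "- k" 0]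
  by (simp add: advance2_def)

lemma advance2_swap:
  assumes s: "coherent s" "position s = x" and p: "p \<in> pairs x \<alpha> - {idle x}"
  shows "advance2 \<mu> \<alpha> k s (swap x \<alpha> p) = negate (advance2 \<mu> \<alpha> k s p)"
proof -
  have ne: "refl \<alpha> \<circ> x \<noteq> x" using refl_comp_ne[OF a x] .
  note A = advance2_cross_stay[OF s, of \<mu> k]
  note C = advance2_cross_cross[OF s, of \<mu> k]
  show ?thesis
    using p ne ne[symmetric] A C simple_not_both[of "inv x \<alpha>"]
    unfolding pairs_cases swap_def
    by (auto simp: Let_def split: if_splits)
qed

end

lemma advance_negate: "advance \<mu> (negate s) z = negate (advance \<mu> s z)"
  by (simp add: advance_def Let_def negate_def split: prod.splits)

section \<open>Deleting or swapping two steps of a walk\<close>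

lemma walks_Cons_iff:
  "zs \<in> walks x (g # gs) \<longleftrightarrow>
     (\<exists>p ps. zs = p # ps \<and> p \<in> choices x (fst g) \<and> ps \<in> walks (fst p) gs)"
  by auto

declare walks.simps(2) [simp del]

lemma Cons_walks_Cons [simp]:
  "p # ps \<in> walks x (g # gs) \<longleftrightarrow> p \<in> choices x (fst g) \<and> ps \<in> walks (fst p) gs"
  by (simp add: walks_Cons_iff)

lemma length_walks: "zs \<in> walks x gs \<Longrightarrow> length zs = length gs"
  by (induction gs arbitrary: x zs) (auto simp: walks_Cons_iff)

lemma walks_append:
  assumes "length ps = length us"
  shows "ps @ rs \<in> walks x (us @ vs) \<longleftrightarrow>
    ps \<in> walks x us \<and> rs \<in> walks (last (x # map fst ps)) vs"
  using assms by (induction ps us arbitrary: x rule: list_induct2) simp_all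

lemma walks_nth:
  "zs \<in> walks x gs \<longleftrightarrow> length zs = length gs \<and>
     (\<forall>i<length gs. zs ! i \<in> choices ((x # map fst zs) ! i) (fst (gs ! i)))"
proof (induction gs arbitrary: x zs)
  case Nil
  then show ?case by simp
next
  case (Cons g gs)
  show ?case
  proof (cases zs)
    case (Cons p ps)
    then show ?thesis using Cons.IH[of ps "fst p"] by (auto simp: All_less_Suc2)
  qed (simp add: walks_Cons_iff)
qed

lemma run_append:
  "length us = length ps \<Longrightarrow> run \<mu> s (us @ vs) (ps @ rs) = run \<mu> (run \<mu> s us ps) vs rs"
  by (simp add: run_def)

lemma run_negate: "run \<mu> (negate s) gs ps = negate (run \<mu> s gs ps)"
proof -
  have "foldl (advance \<mu>) (negate s) zs = negate (foldl (advance \<mu>) s zs)" for zs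
    by (induction zs arbitrary: s) (simp_all add: advance_negate)
  then show ?thesis by (simp add: run_def)
qed

lemma coherent_run:
  assumes "coherent s" "fst ` set gs \<subseteq> \<Delta>" "zs \<in> walks (position s) gs"
  shows "coherent (run \<mu> s gs zs) \<and> position (run \<mu> s gs zs) = last (position s # map fst zs)"
  using assms
proof (induction gs arbitrary: s zs)
  case Nil
  then show ?case by (simp add: run_def)
next
  case (Cons g gs)
  obtain p ps where z: "zs = p # ps" "p \<in> choices (position s) (fst g)" "ps \<in> walks (fst p) gs"
    using Cons.prems(3) by (auto simp: walks_Cons_iff)
  have "coherent (advance \<mu> s (g, p))"
    using coherent_advance[of s "fst g" p \<mu> "snd g"] Cons.prems z by simp
  from Cons.IH[OF this] show ?case
    using Cons.prems(2) z by (simp add: run_def advance_position)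
qed

lemma coherent_start: "w \<in> weyl \<Delta> \<Longrightarrow> coherent (start w)"
  by (simp add: coherent_def start_def linear_add[OF weyl_inv_linear])

text \<open>
  The next three operations act on a whole walk, at the two steps that follow the first \<open>n\<close>.
\<close>
definition insert_idle :: "('a \<Rightarrow> 'a) \<Rightarrow> nat \<Rightarrow> 'a choice list \<Rightarrow> 'a choice list" where
  "insert_idle w n zs =
     (let x = last (w # map fst (take n zs)) in take n zs @ [(x, 0), (x, 0)] @ drop n zs)"

definition remove_pair :: "nat \<Rightarrow> 'a choice list \<Rightarrow> 'a choice list" where
  "remove_pair n zs = take n zs @ drop (n + 2) zs"

definition swap_walk :: "('a \<Rightarrow> 'a) \<Rightarrow> 'a \<Rightarrow> nat \<Rightarrow> 'a choice list \<Rightarrow> 'a choice list" where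
  "swap_walk w \<alpha> n zs =
     (let (q1, q2) = swap (last (w # map fst (take n zs))) \<alpha> (zs ! n, zs ! Suc n)
      in take n zs @ [q1, q2] @ drop (n + 2) zs)"

context
  fixes w :: "'a \<Rightarrow> 'a" and \<alpha> \<mu> :: 'a and k :: int and us vs gs :: "('a \<times> int) list" and n :: nat
  assumes w: "w \<in> weyl \<Delta>" and a: "\<alpha> \<in> \<Delta>" and us: "fst ` set us \<subseteq> \<Delta>"
  defines "gs \<equiv> us @ [(\<alpha>, k), (- \<alpha>, - k)] @ vs" and "n \<equiv> length us"
begin

lemma walk_split:
  assumes "length ps = n"
  shows "ps @ [p1, p2] @ rs \<in> walks w gs \<longleftrightarrow>
    ps \<in> walks w us \<and> (p1, p2) \<in> pairs (last (w # map fst ps)) \<alpha> \<and> rs \<in> walks (fst p2) vs"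
  using walks_append[of ps us "[p1, p2] @ rs" w "[(\<alpha>, k), (- \<alpha>, - k)] @ vs"] assms
  by (simp add: gs_def n_def pairs_def)

lemma run_split:
  assumes "length ps = n"
  shows "run \<mu> s gs (ps @ [p1, p2] @ rs) =
    run \<mu> (advance2 \<mu> \<alpha> k (run \<mu> s us ps) (p1, p2)) vs rs"
  using run_append[of us ps \<mu> s "[(\<alpha>, k), (- \<alpha>, - k)] @ vs" "[p1, p2] @ rs"] assms
  by (simp add: gs_def n_def run_def advance2_def)

lemma before_pair:
  assumes "ps \<in> walks w us"
  shows "coherent (run \<mu> (start w) us ps)"
    and "position (run \<mu> (start w) us ps) = last (w # map fst ps)"
    and "last (w # map fst ps) \<in> weyl \<Delta>"
proof -
  have "coherent (run \<mu> (start w) us ps) \<and>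
      position (run \<mu> (start w) us ps) = last (position (start w) # map fst ps)"
    by (rule coherent_run[OF coherent_start[OF w] us]) (simp add: start_def assms)
  then show "coherent (run \<mu> (start w) us ps)"
    and "position (run \<mu> (start w) us ps) = last (w # map fst ps)"
    and "last (w # map fst ps) \<in> weyl \<Delta>"
    by (auto simp: coherent_def start_def)
qed

lemma walks_reduced_split:
  assumes "zs \<in> walks w (us @ vs)"
  obtains ps rs where "zs = ps @ rs" "length ps = n" "ps \<in> walks w us"
    "rs \<in> walks (last (w # map fst ps)) vs"
proof -
  have l: "length (take n zs) = length us" using length_walks[OF assms] by (simp add: n_def)
  show ?thesis
    using that[of "take n zs" "drop n zs"] walks_append[OF l, of "drop n zs" w vs] assms l
    by (simp add: n_def)
qed

lemma walks_pair_split: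
  assumes "zs \<in> walks w gs"
  obtains ps p1 p2 rs where "zs = ps @ [p1, p2] @ rs" "length ps = n" "ps \<in> walks w us"
    "(p1, p2) \<in> pairs (last (w # map fst ps)) \<alpha>" "rs \<in> walks (fst p2) vs"
proof -
  have l: "length zs = n + 2 + length vs" using length_walks[OF assms] by (simp add: gs_def n_def)
  have z: "zs = take n zs @ [zs ! n, zs ! Suc n] @ drop (n + 2) zs"
    using l id_take_nth_drop[of n zs] by (simp add: Cons_nth_drop_Suc)
  have "take n zs @ [zs ! n, zs ! Suc n] @ drop (n + 2) zs \<in> walks w gs" using assms z by simp
  moreover have "length (take n zs) = n" using l by simp
  ultimately show ?thesis using that[OF z] walk_split by blast
qed

lemma insert_idle_walk:
  assumes "zs \<in> walks w (us @ vs)"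
  shows "insert_idle w n zs \<in> walks w gs" and "remove_pair n (insert_idle w n zs) = zs"
    and "run \<mu> (start w) gs (insert_idle w n zs) = run \<mu> (start w) (us @ vs) zs"
proof -
  obtain ps rs where z: "zs = ps @ rs" "length ps = n" "ps \<in> walks w us"
    "rs \<in> walks (last (w # map fst ps)) vs" using walks_reduced_split[OF assms] .
  let ?x = "last (w # map fst ps)"
  have i: "insert_idle w n zs = ps @ [(?x, 0), (?x, 0)] @ rs"
    using z by (simp add: insert_idle_def Let_def)
  have "idle ?x \<in> pairs ?x \<alpha>" using pairs_cases[OF before_pair(3)[OF z(3)] a] by auto
  then show "insert_idle w n zs \<in> walks w gs"
    unfolding i walk_split[OF z(2)] using z by simp
  show "remove_pair n (insert_idle w n zs) = zs"
    unfolding i using z by (simp add: remove_pair_def)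
  show "run \<mu> (start w) gs (insert_idle w n zs) = run \<mu> (start w) (us @ vs) zs"
    unfolding i run_split[OF z(2)] advance2_idle[OF before_pair(3)[OF z(3)] a before_pair(2)[OF z(3)]]
    using z by (simp add: run_append n_def)
qed

lemma remove_pair_bij:
  "bij_betw (remove_pair n) (insert_idle w n ` walks w (us @ vs)) (walks w (us @ vs))"
  by (rule bij_betw_byWitness[of _ "insert_idle w n"]) (auto simp: insert_idle_walk)

lemma swap_walk_cancels:
  assumes "zs \<in> walks w gs - insert_idle w n ` walks w (us @ vs)"
  shows "swap_walk w \<alpha> n zs \<in> walks w gs - insert_idle w n ` walks w (us @ vs)"
    and "swap_walk w \<alpha> n (swap_walk w \<alpha> n zs) = zs"
    and "run \<mu> (start w) gs (swap_walk w \<alpha> n zs) = negate (run \<mu> (start w) gs zs)"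
proof -
  obtain ps p1 p2 rs where z: "zs = ps @ [p1, p2] @ rs" "length ps = n" "ps \<in> walks w us"
    "(p1, p2) \<in> pairs (last (w # map fst ps)) \<alpha>" "rs \<in> walks (fst p2) vs"
    using walks_pair_split assms by blast
  define x where "x = last (w # map fst ps)"
  have xW: "x \<in> weyl \<Delta>" using before_pair(3)[OF z(3)] by (simp add: x_def)
  have idle: "ps @ [q1, q2] @ rs' \<in> insert_idle w n ` walks w (us @ vs) \<longleftrightarrow> (q1, q2) = idle x"
    if "rs' \<in> walks (fst q2) vs" for q1 q2 rs'
  proof
    assume "ps @ [q1, q2] @ rs' \<in> insert_idle w n ` walks w (us @ vs)"
    then obtain zs' where "zs' \<in> walks w (us @ vs)" "ps @ [q1, q2] @ rs' = insert_idle w n zs'"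
      by auto
    then obtain ps' rs'' where "ps @ [q1, q2] @ rs' = insert_idle w n (ps' @ rs'')" "length ps' = n"
      using walks_reduced_split by metis
    then show "(q1, q2) = idle x" using z(2) by (auto simp: insert_idle_def Let_def x_def)
  next
    assume q: "(q1, q2) = idle x"
    then have "ps @ [q1, q2] @ rs' = insert_idle w n (ps @ rs')"
      using z(2) by (simp add: insert_idle_def Let_def x_def)
    moreover have "ps @ rs' \<in> walks w (us @ vs)"
      using walks_append[of ps us rs' w vs] z q that by (simp add: n_def x_def)
    ultimately show "ps @ [q1, q2] @ rs' \<in> insert_idle w n ` walks w (us @ vs)" by blast
  qed
  have p: "(p1, p2) \<in> pairs x \<alpha> - {idle x}" using z idle[OF z(5)] assms by (simp add: x_def)
  obtain q1 q2 where q: "swap x \<alpha> (p1, p2) = (q1, q2)" by (rule prod.exhaust)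
  note sp = swap_pairs[OF xW a p, unfolded q]
  have s: "swap_walk w \<alpha> n (ps @ [r1, r2] @ rs) =
      ps @ [fst (swap x \<alpha> (r1, r2)), snd (swap x \<alpha> (r1, r2))] @ rs" for r1 r2
    using z(2) by (simp add: swap_walk_def nth_append x_def split: prod.splits)
  have sz: "swap_walk w \<alpha> n zs = ps @ [q1, q2] @ rs" unfolding z(1) s q by simp
  show "swap_walk w \<alpha> n zs \<in> walks w gs - insert_idle w n ` walks w (us @ vs)"
  proof -
    have rs: "rs \<in> walks (fst q2) vs" using sp(3) z(5) by simp
    then have "ps @ [q1, q2] @ rs \<in> walks w gs"
      using walk_split[OF z(2), folded x_def] z(3) sp(1) by blast
    then show ?thesis unfolding sz using idle[OF rs] sp(1) by blast
  qed
  show "swap_walk w \<alpha> n (swap_walk w \<alpha> n zs) = zs"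
    unfolding sz s sp(2) by (simp add: z(1))
  show "run \<mu> (start w) gs (swap_walk w \<alpha> n zs) = negate (run \<mu> (start w) gs zs)"
    unfolding sz unfolding z(1) run_split[OF z(2)] run_negate[symmetric]
    using advance2_swap[OF xW a before_pair(1)[OF z(3)] before_pair(2)[OF z(3), folded x_def] p]
    by (simp add: q)
qed

end

end

section \<open>Encoding decorated walks\<close>
definition path_steps :: "'a path_data \<Rightarrow> ('a \<times> int) list" where
  "path_steps \<Gamma> = zip (path_roots \<Gamma>) (path_levels \<Gamma>)"

lemma Collect_le_Suc:
  "{u. u \<le> Suc t \<and> u \<in> A} =
     (if Suc t \<in> A then insert (Suc t) {u. u \<le> t \<and> u \<in> A} else {u. u \<le> t \<and> u \<in> A})"
  by (auto simp: le_Suc_eq)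

lemma sum_le_Suc:
  fixes f :: "nat \<Rightarrow> 'b::comm_monoid_add"
  shows "(\<Sum>u | u \<le> Suc t \<and> u \<in> A. f u) =
    (\<Sum>u | u \<le> t \<and> u \<in> A. f u) + (if Suc t \<in> A then f (Suc t) else 0)"
  by (simp add: Collect_le_Suc add.commute)

lemma prod_le_Suc:
  fixes f :: "nat \<Rightarrow> 'b::comm_monoid_mult"
  shows "(\<Prod>u | u \<le> Suc t \<and> u \<in> A. f u) =
    (\<Prod>u | u \<le> t \<and> u \<in> A. f u) * (if Suc t \<in> A then f (Suc t) else 1)"
  by (simp add: Collect_le_Suc mult.commute)

context based_root_system
begin

definition encode :: "'a path_data \<Rightarrow> 'a decorated_walk \<Rightarrow> 'a choice list" where
  "encode \<Gamma> = (\<lambda>(ws, b).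
     map (\<lambda>t. (ws ! Suc t, if Suc t \<in> Sset B \<Gamma> ws then b (Suc t) else 0)) [0..<path_len \<Gamma>])"

definition decode :: "'a path_data \<Rightarrow> ('a \<Rightarrow> 'a) \<Rightarrow> 'a choice list \<Rightarrow> 'a decorated_walk" where
  "decode \<Gamma> w zs =
     (let ws = w # map fst zs
      in (ws, \<lambda>t. if t \<in> Sset B \<Gamma> ws then snd (zs ! (t - 1)) else undefined))"

lemma walks_weyl:
  "zs \<in> walks x gs \<Longrightarrow> x \<in> weyl \<Delta> \<Longrightarrow> fst ` set gs \<subseteq> \<Delta> \<Longrightarrow> set (map fst zs) \<subseteq> weyl \<Delta>"
proof (induction gs arbitrary: x zs)
  case (Cons g gs)
  then show ?case using choices_weyl[of x "fst g"] by (fastforce simp: walks_Cons_iff)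
qed simp

context
  fixes \<Gamma> :: "'a path_data" and w :: "'a \<Rightarrow> 'a"
  assumes lev: "length (path_levels \<Gamma>) = path_len \<Gamma>" and roots: "set (path_roots \<Gamma>) \<subseteq> \<Delta>"
    and w: "w \<in> weyl \<Delta>"
begin

lemma length_path_steps: "length (path_steps \<Gamma>) = path_len \<Gamma>"
  using lev by (simp add: path_steps_def path_len_def)

lemma nth_path_steps:
  "i < path_len \<Gamma> \<Longrightarrow> path_steps \<Gamma> ! i = (step_root \<Gamma> (Suc i), step_level \<Gamma> (Suc i))"
  using lev by (simp add: path_steps_def path_len_def step_root_def step_level_def)

lemma step_root_mem: "i < path_len \<Gamma> \<Longrightarrow> step_root \<Gamma> (Suc i) \<in> \<Delta>"
  using roots by (auto simp: step_root_def path_len_def)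

lemma QW_step:
  assumes ws: "ws \<in> QW \<Delta> B w \<Gamma>" and i: "i < path_len \<Gamma>"
  shows "ws ! i \<in> weyl \<Delta>"
    and "ws ! Suc i = ws ! i \<or>
      ws ! Suc i = refl (step_root \<Gamma> (Suc i)) \<circ> ws ! i \<and>
      (\<exists>\<alpha>. qbg_edge \<Delta> B (ws ! i) \<alpha> (ws ! Suc i))"
proof -
  have "ws ! i \<in> set ws" using ws i by (auto simp: QW_def)
  then show "ws ! i \<in> weyl \<Delta>" using ws by (auto simp: QW_def)
  have "Suc i \<in> {1..path_len \<Gamma>}" using i by simp
  then show "ws ! Suc i = ws ! i \<or>
      ws ! Suc i = refl (step_root \<Gamma> (Suc i)) \<circ> ws ! i \<and>
      (\<exists>\<alpha>. qbg_edge \<Delta> B (ws ! i) \<alpha> (ws ! Suc i))"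
    using ws unfolding QW_def by fastforce
qed

lemma Sset_Suc:
  "i < path_len \<Gamma> \<Longrightarrow> Suc i \<in> Sset B \<Gamma> ws \<longleftrightarrow>
     ws ! Suc i = ws ! i \<and> - inv (ws ! Suc i) (step_root \<Gamma> (Suc i)) \<in> B"
  by (simp add: Sset_def)

lemma Tset_Suc:
  "i < path_len \<Gamma> \<Longrightarrow> Suc i \<in> Tset \<Gamma> ws \<longleftrightarrow>
     ws ! Suc i = refl (step_root \<Gamma> (Suc i)) \<circ> ws ! i"
  by (simp add: Tset_def)

lemma Tminus_Suc:
  "i < path_len \<Gamma> \<Longrightarrow> Suc i \<in> Tminus \<Delta> B \<Gamma> ws \<longleftrightarrow> bruhat_less \<Delta> B (ws ! Suc i) (ws ! i)"
  by (simp add: Tminus_def)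

lemma length_encode: "length (encode \<Gamma> p) = path_len \<Gamma>"
  by (simp add: encode_def split: prod.splits)

lemma nth_encode:
  "i < path_len \<Gamma> \<Longrightarrow> encode \<Gamma> (ws, b) ! i =
     (ws ! Suc i, if Suc i \<in> Sset B \<Gamma> ws then b (Suc i) else 0)"
  by (simp add: encode_def)

lemma encode_positions:
  assumes "(ws, b) \<in> QWt \<Delta> B w \<Gamma>"
  shows "w # map fst (encode \<Gamma> (ws, b)) = ws"
proof (rule nth_equalityI)
  have ws: "length ws = path_len \<Gamma> + 1" "ws ! 0 = w" using assms by (auto simp: QWt_def QW_def)
  show "length (w # map fst (encode \<Gamma> (ws, b))) = length ws" by (simp add: length_encode ws)
  fix i assume "i < length (w # map fst (encode \<Gamma> (ws, b)))"
  then show "(w # map fst (encode \<Gamma> (ws, b))) ! i = ws ! i"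
    by (cases i) (simp_all add: length_encode nth_encode ws(2))
qed

lemma encode_walk:
  assumes p: "(ws, b) \<in> QWt \<Delta> B w \<Gamma>"
  shows "encode \<Gamma> (ws, b) \<in> walks w (path_steps \<Gamma>)"
  unfolding walks_nth encode_positions[OF p] length_path_steps
proof (intro conjI allI impI length_encode)
  fix i assume i: "i < path_len \<Gamma>"
  have ws: "ws \<in> QW \<Delta> B w \<Gamma>" and b: "b \<in> Sset B \<Gamma> ws \<rightarrow>\<^sub>E {0, 1}"
    using p by (auto simp: QWt_def)
  note ne = refl_comp_ne[OF step_root_mem[OF i] QW_step(1)[OF ws i]]
  have "b (Suc i) \<in> {0, 1}" if "Suc i \<in> Sset B \<Gamma> ws" using PiE_mem[OF b that] .
  then show "encode \<Gamma> (ws, b) ! i \<in> choices (ws ! i) (fst (path_steps \<Gamma> ! i))"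
    using QW_step(2)[OF ws i] ne i
    by (auto simp: nth_encode nth_path_steps choices_def Sset_Suc)
qed

lemma decode_encode:
  assumes p: "(ws, b) \<in> QWt \<Delta> B w \<Gamma>"
  shows "decode \<Gamma> w (encode \<Gamma> (ws, b)) = (ws, b)"
proof -
  have b: "b \<in> Sset B \<Gamma> ws \<rightarrow>\<^sub>E {0, 1}" using p by (auto simp: QWt_def)
  have "(if t \<in> Sset B \<Gamma> ws then snd (encode \<Gamma> (ws, b) ! (t - 1)) else undefined) = b t" for t
  proof (cases "t \<in> Sset B \<Gamma> ws")
    case True
    then have "t - 1 < path_len \<Gamma>" "Suc (t - 1) = t" by (auto simp: Sset_def)
    then show ?thesis using True nth_encode[of "t - 1" ws b] by simp
  next
    case False
    then show ?thesis using PiE_arb[OF b] by simp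
  qed
  then show ?thesis unfolding decode_def encode_positions[OF p] by simp
qed

lemma walks_choice:
  assumes "zs \<in> walks w (path_steps \<Gamma>)" and "i < path_len \<Gamma>"
  shows "zs ! i \<in> choices ((w # map fst zs) ! i) (step_root \<Gamma> (Suc i))"
    and "(w # map fst zs) ! Suc i = fst (zs ! i)"
  using assms unfolding walks_nth by (auto simp: length_path_steps nth_path_steps)

lemma decode_mem:
  assumes zs: "zs \<in> walks w (path_steps \<Gamma>)"
  shows "decode \<Gamma> w zs \<in> QWt \<Delta> B w \<Gamma>"
proof -
  define ws where "ws = w # map fst zs"
  have l: "length zs = path_len \<Gamma>" using length_walks[OF zs] by (simp add: length_path_steps)
  have W: "set ws \<subseteq> weyl \<Delta>"
  proof -
    have "fst ` set (path_steps \<Gamma>) \<subseteq> \<Delta>"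
      using roots by (auto simp: path_steps_def dest: set_zip_leftD)
    then show ?thesis using walks_weyl[OF zs w] w by (simp add: ws_def)
  qed
  have st: "ws ! Suc i \<in> {ws ! i, refl (step_root \<Gamma> (Suc i)) \<circ> ws ! i} \<and>
      (ws ! Suc i = refl (step_root \<Gamma> (Suc i)) \<circ> ws ! i \<longrightarrow>
        (\<exists>\<alpha>. qbg_edge \<Delta> B (ws ! i) \<alpha> (ws ! Suc i))) \<and> snd (zs ! i) \<in> {0, 1}"
    if i: "i < path_len \<Gamma>" for i
  proof -
    have "ws ! i \<in> set ws" using i l by (intro nth_mem) (simp add: ws_def)
    then have "ws ! i \<in> weyl \<Delta>" using W by blast
    note ne = refl_comp_ne[OF step_root_mem[OF i] this]
    show ?thesis using walks_choice[OF zs i, folded ws_def] ne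
      by (auto simp: choices_def split: if_splits)
  qed
  have "ws \<in> QW \<Delta> B w \<Gamma>"
    unfolding QW_def
  proof (intro CollectI conjI ballI)
    show "length ws = path_len \<Gamma> + 1" "set ws \<subseteq> weyl \<Delta>" "ws ! 0 = w"
      using l W by (simp_all add: ws_def)
    fix t assume "t \<in> {1..path_len \<Gamma>}"
    then obtain i where "t = Suc i" "i < path_len \<Gamma>" by (cases t) auto
    then show "ws ! t \<in> {ws ! (t - 1), refl (step_root \<Gamma> t) \<circ> ws ! (t - 1)}"
      and "ws ! t = refl (step_root \<Gamma> t) \<circ> ws ! (t - 1) \<longrightarrow>
        (\<exists>\<alpha>. qbg_edge \<Delta> B (ws ! (t - 1)) \<alpha> (ws ! t))"
      using st[of i] by simp_all
  qed
  moreover have "(\<lambda>t. if t \<in> Sset B \<Gamma> ws then snd (zs ! (t - 1)) else undefined)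
      \<in> Sset B \<Gamma> ws \<rightarrow>\<^sub>E {0, 1}"
  proof (rule PiE_I)
    fix t assume t: "t \<in> Sset B \<Gamma> ws"
    then have "t - 1 < path_len \<Gamma>" by (auto simp: Sset_def)
    then show "(if t \<in> Sset B \<Gamma> ws then snd (zs ! (t - 1)) else undefined) \<in> {0, 1}"
      using st[of "t - 1"] t by simp
  qed simp
  ultimately show ?thesis by (simp add: decode_def QWt_def ws_def Let_def)
qed

lemma encode_decode:
  assumes zs: "zs \<in> walks w (path_steps \<Gamma>)"
  shows "encode \<Gamma> (decode \<Gamma> w zs) = zs"
proof (rule nth_equalityI)
  have l: "length zs = path_len \<Gamma>" using length_walks[OF zs] by (simp add: length_path_steps)
  show "length (encode \<Gamma> (decode \<Gamma> w zs)) = length zs" by (simp add: length_encode l)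
  fix i assume "i < length (encode \<Gamma> (decode \<Gamma> w zs))"
  then have i: "i < path_len \<Gamma>" by (simp add: length_encode)
  note c = walks_choice[OF zs i]
  show "encode \<Gamma> (decode \<Gamma> w zs) ! i = zs ! i"
    using c l i unfolding decode_def Let_def nth_encode[OF i] Sset_Suc[OF i]
    by (cases "zs ! i") (auto simp: choices_def split: if_splits)
qed

text \<open>
  The state after \<open>t\<close> steps consists of the partial statistics. The sums are restricted to indices at
  most \<open>t\<close>, so that each step adds at most one index to each of them.
\<close>
lemma run_encode:
  assumes p: "(ws, b) \<in> QWt \<Delta> B w \<Gamma>" and t: "t \<le> path_len \<Gamma>"
  shows "foldl (advance \<mu>) (start w) (take t (zip (path_steps \<Gamma>) (encode \<Gamma> (ws, b)))) =
    \<lparr>position = ws ! t, aff_map = rhat \<Gamma> ws t, qsum = qwt_upto \<Delta> B \<Gamma> (ws, b) t,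
     cosum = qwt_co_upto \<Delta> B \<Gamma> (ws, b) t,
     parity = (\<Prod>u | u \<le> t \<and>
         u \<in> {u \<in> Tset \<Gamma> ws. inv (ws ! (u - 1)) (step_root \<Gamma> u) \<in> Pos}. -1) *
       (\<Prod>u | u \<le> t \<and> u \<in> Sset B \<Gamma> ws. (-1) ^ b u),
     partial_deg = (\<Sum>u = 1..t. wt_step \<mu> \<Gamma> ws u \<bullet> qwt_co_upto \<Delta> B \<Gamma> (ws, b) u) -
       (\<Sum>u | u \<le> t \<and> u \<in> Tminus \<Delta> B \<Gamma> ws.
          root_sgn \<Delta> B (step_root \<Gamma> u) * colevel \<mu> \<Gamma> u) -
       (\<Sum>u | u \<le> t \<and> u \<in> Sset B \<Gamma> ws. real (b u) * colevel \<mu> \<Gamma> u)\<rparr>"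
  using t
proof (induction t)
  case 0
  have e: "{u. u = 0 \<and> u \<in> Sset B \<Gamma> ws} = {}" "{u. u = 0 \<and> u \<in> Tminus \<Delta> B \<Gamma> ws} = {}"
    "{u. u = 0 \<and> u \<in> Tset \<Gamma> ws \<and> inv (ws ! (u - Suc 0)) (step_root \<Gamma> u) \<in> Pos} = {}"
    by (auto simp: Sset_def Tminus_def Tset_def)
  have "ws ! 0 = w" using p by (auto simp: QWt_def QW_def)
  then show ?case by (simp add: start_def qwt_upto_def qwt_co_upto_def e)
next
  case (Suc t)
  then have t: "t < path_len \<Gamma>" by simp
  have z: "take (Suc t) (zip (path_steps \<Gamma>) (encode \<Gamma> (ws, b))) =
      take t (zip (path_steps \<Gamma>) (encode \<Gamma> (ws, b))) @
      [((step_root \<Gamma> (Suc t), step_level \<Gamma> (Suc t)),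
        (ws ! Suc t, if Suc t \<in> Sset B \<Gamma> ws then b (Suc t) else 0))]"
    using t by (simp add: take_Suc_conv_app_nth length_path_steps length_encode nth_path_steps
        nth_encode)
  \<comment> \<open>Naming the three conditions keeps the simplifier from substituting the equations in them.\<close>
  define S where "S \<longleftrightarrow> ws ! Suc t = ws ! t \<and> - inv (ws ! Suc t) (step_root \<Gamma> (Suc t)) \<in> B"
  define T where "T \<longleftrightarrow> ws ! Suc t = refl (step_root \<Gamma> (Suc t)) \<circ> ws ! t"
  define D where "D \<longleftrightarrow> bruhat_less \<Delta> B (ws ! Suc t) (ws ! t)"
  note mem = Sset_Suc[OF t, of ws, folded S_def] Tset_Suc[OF t, of ws, folded T_def]
    Tminus_Suc[OF t, of ws, folded D_def]
  define \<gamma> where "\<gamma> = step_root \<Gamma> (Suc t)"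
  define l where "l = step_level \<Gamma> (Suc t)"
  have adv: "advance \<mu> \<lparr>position = ws ! t, aff_map = R, qsum = v, cosum = v', parity = e,
        partial_deg = d\<rparr> ((\<gamma>, l), (ws ! Suc t, c)) =
      \<lparr>position = ws ! Suc t, aff_map = (if T then R \<circ> aff_refl \<gamma> l else R),
       qsum = v + ((if D then root_abs \<Delta> B (inv (ws ! Suc t) \<gamma>) else 0) -
         (if S then real c *\<^sub>R inv (ws ! Suc t) \<gamma> else 0)),
       cosum = v' + ((if D then coroot (root_abs \<Delta> B (inv (ws ! Suc t) \<gamma>)) else 0) -
         (if S then real c *\<^sub>R inv (ws ! Suc t) (coroot \<gamma>) else 0)),
       parity = e * (if T \<and> inv (ws ! t) \<gamma> \<in> Pos then -1 else 1) * (if S then (-1) ^ c else 1),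
       partial_deg = d + (((if T then R \<circ> aff_refl \<gamma> l else R) \<mu> - R \<mu>) \<bullet>
           (v' + ((if D then coroot (root_abs \<Delta> B (inv (ws ! Suc t) \<gamma>)) else 0) -
             (if S then real c *\<^sub>R inv (ws ! Suc t) (coroot \<gamma>) else 0))) -
         (if D then root_sgn \<Delta> B \<gamma> * (\<mu> \<bullet> coroot \<gamma> - of_int l) else 0) -
         (if S then real c * (\<mu> \<bullet> coroot \<gamma> - of_int l) else 0))\<rparr>" for R v v' e d c
    unfolding advance_def Let_def prod.case walk_state.select_convs S_def T_def D_def \<gamma>_def ..
  have rh: "rhat \<Gamma> ws (Suc t) =
      (if T then rhat \<Gamma> ws t \<circ> aff_refl \<gamma> l else rhat \<Gamma> ws t)"
    by (simp add: mem \<gamma>_def l_def)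
  have q: "qwt_upto \<Delta> B \<Gamma> (ws, b) (Suc t) = qwt_upto \<Delta> B \<Gamma> (ws, b) t +
      ((if D then root_abs \<Delta> B (inv (ws ! Suc t) \<gamma>) else 0) -
       (if S then real (b (Suc t)) *\<^sub>R inv (ws ! Suc t) \<gamma> else 0))"
    by (simp add: qwt_upto_def sum_le_Suc mem \<gamma>_def)
  have qc: "qwt_co_upto \<Delta> B \<Gamma> (ws, b) (Suc t) = qwt_co_upto \<Delta> B \<Gamma> (ws, b) t +
      ((if D then coroot (root_abs \<Delta> B (inv (ws ! Suc t) \<gamma>)) else 0) -
       (if S then real (b (Suc t)) *\<^sub>R inv (ws ! Suc t) (coroot \<gamma>) else 0))"
    by (simp add: qwt_co_upto_def sum_le_Suc mem \<gamma>_def)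
  have wst: "wt_step \<mu> \<Gamma> ws (Suc t) =
      (if T then rhat \<Gamma> ws t \<circ> aff_refl \<gamma> l else rhat \<Gamma> ws t) \<mu> - rhat \<Gamma> ws t \<mu>"
    unfolding wt_step_def rh by simp
  have col: "colevel \<mu> \<Gamma> (Suc t) = \<mu> \<bullet> coroot \<gamma> - of_int l"
    by (simp add: colevel_def \<gamma>_def l_def)
  have T': "Suc t \<in> {u \<in> Tset \<Gamma> ws. inv (ws ! (u - 1)) (step_root \<Gamma> u) \<in> Pos} \<longleftrightarrow>
      T \<and> inv (ws ! t) \<gamma> \<in> Pos"
    by (simp add: mem \<gamma>_def)
  have Sum: "(\<Sum>u = 1..Suc t. h u) = (\<Sum>u = 1..t. h u) + h (Suc t)" for h :: "nat \<Rightarrow> real"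
    by simp
  show ?case
    unfolding z foldl_append Suc.IH[OF less_imp_le[OF t]] foldl.simps mem
      \<gamma>_def[symmetric] l_def[symmetric] adv sum_le_Suc prod_le_Suc T' Sum rh q qc wst col
    by (cases S) (simp_all add: mult.assoc mult.left_commute)
qed

lemma statistics_run:
  fixes \<mu> :: 'a
  assumes p: "p \<in> QWt \<Delta> B w \<Gamma>"
  defines "s \<equiv> run \<mu> (start w) (path_steps \<Gamma>) (encode \<Gamma> p)"
  shows "walk_sign \<Delta> B \<Gamma> p = parity s" and "walk_end \<Gamma> p = position s"
    and "qwt \<Delta> B \<Gamma> p = qsum s" and "qwt_co \<Delta> B \<Gamma> p = cosum s"
    and "wt \<mu> \<Gamma> p = aff_map s \<mu>"
    and "deg \<Delta> B \<mu> \<Gamma> p = (1 / 2) * (qsum s \<bullet> cosum s) + partial_deg s"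
proof -
  obtain ws b where wb: "p = (ws, b)" by (rule prod.exhaust)
  have full: "{u. u \<le> path_len \<Gamma> \<and> u \<in> Sset B \<Gamma> ws} = Sset B \<Gamma> ws"
    "{u. u \<le> path_len \<Gamma> \<and> u \<in> Tminus \<Delta> B \<Gamma> ws} = Tminus \<Delta> B \<Gamma> ws"
    "{u. u \<le> path_len \<Gamma> \<and> u \<in> {u \<in> Tset \<Gamma> ws. inv (ws ! (u - 1)) (step_root \<Gamma> u) \<in> Pos}} =
     {u. u \<in> Tset \<Gamma> ws \<and> inv (ws ! (u - 1)) (step_root \<Gamma> u) \<in> Pos}"
    by (auto simp: Sset_def Tminus_def Tset_def)
  have s: "s = foldl (advance \<mu>) (start w)
      (take (path_len \<Gamma>) (zip (path_steps \<Gamma>) (encode \<Gamma> (ws, b))))"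
    unfolding s_def run_def wb by (simp add: length_path_steps length_encode)
  note s' = s[unfolded run_encode[OF p[unfolded wb] order_refl] full]
  show "walk_sign \<Delta> B \<Gamma> p = parity s" and "walk_end \<Gamma> p = position s"
    and "qwt \<Delta> B \<Gamma> p = qsum s" and "qwt_co \<Delta> B \<Gamma> p = cosum s"
    and "wt \<mu> \<Gamma> p = aff_map s \<mu>"
    and "deg \<Delta> B \<mu> \<Gamma> p = (1 / 2) * (qsum s \<bullet> cosum s) + partial_deg s"
    unfolding s' wb
    by (simp_all add: walk_sign_def walk_end_def qwt_def qwt_co_def wt_def deg_def)
qed

lemma decode_bij: "bij_betw (decode \<Gamma> w) (walks w (path_steps \<Gamma>)) (QWt \<Delta> B w \<Gamma>)"
  by (rule bij_betw_byWitness[of _ "encode \<Gamma>"])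
    (auto simp: decode_encode encode_decode encode_walk decode_mem)

lemma encode_bij: "bij_betw (encode \<Gamma>) (QWt \<Delta> B w \<Gamma>) (walks w (path_steps \<Gamma>))"
  by (rule bij_betw_byWitness[of _ "decode \<Gamma> w"])
    (auto simp: decode_encode encode_decode encode_walk decode_mem)

end

end

section \<open>Comparing the two paths\<close>

lemma alcove_path_valid:
  assumes path: "alcove_path \<Delta> B \<mu> \<Gamma>"
  shows "length (path_levels \<Gamma>) = path_len \<Gamma>" and "set (path_roots \<Gamma>) \<subseteq> \<Delta>"
proof -
  show "length (path_levels \<Gamma>) = path_len \<Gamma>" using path by (simp add: alcove_path_def)
  show "set (path_roots \<Gamma>) \<subseteq> \<Delta>"
    using alcove_path_step[OF path] by (auto simp: in_set_conv_nth alcove_step_def)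
qed

theorem theorem3p14:
  fixes \<Delta> B :: "'a::euclidean_space set"
    and \<mu> :: 'a
    and w :: "'a \<Rightarrow> 'a"
    and \<Gamma> \<Xi> :: "'a path_data"
  assumes "root_system \<Delta>" and "irreducible_roots \<Delta>" and "simply_laced \<Delta>"
    and "root_base \<Delta> B" and "\<not> type_E8 B"
    and "\<mu> \<in> weight_lattice \<Delta>" and "w \<in> weyl \<Delta>"
    and "alcove_path \<Delta> B \<mu> \<Gamma>" and "alcove_path \<Delta> B \<mu> \<Xi>"
    and "deletion \<Delta> \<Gamma> \<Xi>"
  shows "\<exists>QW1 \<subseteq> QWt \<Delta> B w \<Gamma>.
    (\<exists>D. bij_betw D QW1 (QWt \<Delta> B w \<Xi>) \<and>
       (\<forall>p\<in>QW1.
          walk_sign \<Delta> B \<Xi> (D p) = walk_sign \<Delta> B \<Gamma> p \<and>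
          walk_end \<Xi> (D p) = walk_end \<Gamma> p \<and>
          qwt \<Delta> B \<Xi> (D p) = qwt \<Delta> B \<Gamma> p \<and>
          qwt_co \<Delta> B \<Xi> (D p) = qwt_co \<Delta> B \<Gamma> p \<and>
          wt \<mu> \<Xi> (D p) = wt \<mu> \<Gamma> p \<and>
          deg \<Delta> B \<mu> \<Xi> (D p) = deg \<Delta> B \<mu> \<Gamma> p)) \<and>
    (\<exists>D. \<forall>p\<in>QWt \<Delta> B w \<Gamma> - QW1.
          D p \<in> QWt \<Delta> B w \<Gamma> - QW1 \<and> D (D p) = p \<and>
          walk_sign \<Delta> B \<Gamma> (D p) = - walk_sign \<Delta> B \<Gamma> p \<and>
          walk_end \<Gamma> (D p) = walk_end \<Gamma> p \<and>
          qwt \<Delta> B \<Gamma> (D p) = qwt \<Delta> B \<Gamma> p \<and>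
          qwt_co \<Delta> B \<Gamma> (D p) = qwt_co \<Delta> B \<Gamma> p \<and>
          wt \<mu> \<Gamma> (D p) = wt \<mu> \<Gamma> p \<and>
          deg \<Delta> B \<mu> \<Gamma> (D p) = deg \<Delta> B \<mu> \<Gamma> p)"
proof -
  interpret based_root_system \<Delta> B using assms(1,3,4) by unfold_locales
  note w = assms(7) and G = assms(8) and X = assms(9)
  obtain us \<alpha> vs where a: "\<alpha> \<in> \<Delta>" and rG: "path_roots \<Gamma> = us @ [\<alpha>, - \<alpha>] @ vs"
      and rX: "path_roots \<Xi> = us @ vs"
    using assms(10) unfolding deletion_def by blast
  obtain ls k ms where lev: "path_levels \<Gamma> = ls @ [k, - k] @ ms" "path_levels \<Xi> = ls @ ms"
      "length ls = length us" "length ms = length vs"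
    using deletion_levels[OF assms(1) G X a rG rX] .
  define U V where "U = zip us ls" and "V = zip vs ms"
  have sG: "path_steps \<Gamma> = U @ [(\<alpha>, k), (- \<alpha>, - k)] @ V" and sX: "path_steps \<Xi> = U @ V"
    using lev rG rX by (simp_all add: path_steps_def U_def V_def)
  note vG = alcove_path_valid[OF G] and vX = alcove_path_valid[OF X]
  have U: "fst ` set U \<subseteq> \<Delta>"
    using vG(2) rG by (auto simp: U_def dest: set_zip_leftD)
  note insert = insert_idle_walk(1)[OF w a U, where vs = V and k = k, folded sG sX]
      insert_idle_walk(2)[OF w a U, where vs = V, folded sX]
      insert_idle_walk(3)[OF w a U, where vs = V and k = k, folded sG sX]
    and bij = remove_pair_bij[OF w a U, where vs = V, folded sX]
    and swap = swap_walk_cancels[OF w a U, where vs = V and k = k, folded sG sX]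
  note eG = encode_bij[OF vG w] and dG = decode_mem[OF vG w] encode_decode[OF vG w]
    and dX = decode_mem[OF vX w] encode_decode[OF vX w]
  define n where "n = length U"
  define I where "I = insert_idle w n ` walks w (path_steps \<Xi>)"
  define QW1 where "QW1 = {p \<in> QWt \<Delta> B w \<Gamma>. encode \<Gamma> p \<in> I}"
  define D where "D = decode \<Xi> w \<circ> (remove_pair n \<circ> encode \<Gamma>)"
  define D' where "D' = decode \<Gamma> w \<circ> (swap_walk w \<alpha> n \<circ> encode \<Gamma>)"
  have I: "I \<subseteq> walks w (path_steps \<Gamma>)" using insert(1) by (auto simp: I_def n_def)
  have img: "encode \<Gamma> ` QW1 = I"
    using bij_betw_imp_surj_on[OF eG] I by (auto simp: QW1_def)
  have "bij_betw (encode \<Gamma>) QW1 I"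
    by (rule bij_betw_subset[OF eG _ img]) (simp add: QW1_def)
  then have Dbij: "bij_betw D QW1 (QWt \<Delta> B w \<Xi>)"
    unfolding D_def using bij decode_bij[OF vX w]
    by (auto intro!: bij_betw_trans simp: I_def n_def)
  have sub: "QW1 \<subseteq> QWt \<Delta> B w \<Gamma>" by (auto simp: QW1_def)
  have D1: "walk_sign \<Delta> B \<Xi> (D p) = walk_sign \<Delta> B \<Gamma> p \<and>
      walk_end \<Xi> (D p) = walk_end \<Gamma> p \<and> qwt \<Delta> B \<Xi> (D p) = qwt \<Delta> B \<Gamma> p \<and>
      qwt_co \<Delta> B \<Xi> (D p) = qwt_co \<Delta> B \<Gamma> p \<and> wt \<mu> \<Xi> (D p) = wt \<mu> \<Gamma> p \<and>
      deg \<Delta> B \<mu> \<Xi> (D p) = deg \<Delta> B \<mu> \<Gamma> p" if p: "p \<in> QW1" for p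
  proof -
    have pG: "p \<in> QWt \<Delta> B w \<Gamma>" and pX: "D p \<in> QWt \<Delta> B w \<Xi>"
      using p sub Dbij bij_betwE by blast+
    obtain zs where zs: "zs \<in> walks w (path_steps \<Xi>)" "encode \<Gamma> p = insert_idle w n zs"
      using p by (auto simp: QW1_def I_def)
    have "encode \<Xi> (D p) = zs"
      using insert(2)[OF zs(1)] dX(2)[OF zs(1)] zs(2) by (simp add: D_def n_def)
    then have "run \<mu> (start w) (path_steps \<Xi>) (encode \<Xi> (D p)) =
        run \<mu> (start w) (path_steps \<Gamma>) (encode \<Gamma> p)"
      using insert(3)[OF zs(1)] zs(2) by (simp add: n_def)
    then show ?thesis
      by (simp add: statistics_run[OF vG w pG, of \<mu>] statistics_run[OF vX w pX, of \<mu>])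
  qed
  have D2: "D' p \<in> QWt \<Delta> B w \<Gamma> - QW1 \<and> D' (D' p) = p \<and>
      walk_sign \<Delta> B \<Gamma> (D' p) = - walk_sign \<Delta> B \<Gamma> p \<and>
      walk_end \<Gamma> (D' p) = walk_end \<Gamma> p \<and> qwt \<Delta> B \<Gamma> (D' p) = qwt \<Delta> B \<Gamma> p \<and>
      qwt_co \<Delta> B \<Gamma> (D' p) = qwt_co \<Delta> B \<Gamma> p \<and> wt \<mu> \<Gamma> (D' p) = wt \<mu> \<Gamma> p \<and>
      deg \<Delta> B \<mu> \<Gamma> (D' p) = deg \<Delta> B \<mu> \<Gamma> p" if p: "p \<in> QWt \<Delta> B w \<Gamma> - QW1" for p
  proof -
    have pG: "p \<in> QWt \<Delta> B w \<Gamma>" using p by blast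
    have z: "encode \<Gamma> p \<in> walks w (path_steps \<Gamma>) - I"
      using p bij_betwE[OF eG] by (auto simp: QW1_def)
    note sw = swap[folded n_def, folded I_def, OF z]
    have e: "encode \<Gamma> (D' p) = swap_walk w \<alpha> n (encode \<Gamma> p)"
      using sw(1) dG(2) by (simp add: D'_def)
    have pG': "D' p \<in> QWt \<Delta> B w \<Gamma>" using sw(1) dG(1) by (simp add: D'_def)
    have "D' (D' p) = decode \<Gamma> w (swap_walk w \<alpha> n (encode \<Gamma> (D' p)))" by (simp add: D'_def)
    also have "\<dots> = decode \<Gamma> w (encode \<Gamma> p)" unfolding e sw(2) ..
    also have "\<dots> = p" using decode_encode[OF vG w] pG by (cases p) simp
    finally have inv: "D' (D' p) = p" .
    have "run \<mu> (start w) (path_steps \<Gamma>) (encode \<Gamma> (D' p)) =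
        negate (run \<mu> (start w) (path_steps \<Gamma>) (encode \<Gamma> p))"
      unfolding e by (rule sw(3))
    then show ?thesis
      using inv pG' sw(1) e
      by (simp add: statistics_run[OF vG w pG, of \<mu>] statistics_run[OF vG w pG', of \<mu>]
          negate_def QW1_def)
  qed
  show ?thesis
    by (rule exI[of _ QW1]) (use sub Dbij D1 D2 in blast)
qed

end
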